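(* Let $G$ be a finite solvable group of derived length $d$. (i) If $|G|$ is odd, then $\exp(D(G))$ divides $\exp(G)^{d}$ and $\exp(\chi(G))$ divides $\exp(G)^{d+1}$. (ii) If $|G|$ is even, then $\exp(D(G))$ divides $2^{d-1}\cdot \exp(G)^{d}$ and $\exp(\chi(G))$ divides $2^{d-1}\cdot \exp(G)^{d+1}$.
   Context: For a group $G$, let $G^{\varphi}$ be a copy of $G$, isomorphic to $G$ via $\varphi: G\to G^{\varphi}$, $g\mapsto g^{\varphi}$. The weak commutativity group of $G$ is $\chi(G)=\langle G\cup G^{\varphi}\mid [g,g^{\varphi}]=1 \text{ for all } g\in G\rangle$, i.e. the quotient of the free product $G * G^{\varphi}$ by the normal closure of all $[g,g^{\varphi}]$, $g\in G$; the groups $G$ and $G^{\varphi}$ are identified with their (isomorphic) images in $\chi(G)$. Commutators are $[x,y]=x^{-1}y^{-1}xy$. $D(G)=[G,G^{\varphi}]=\langle [g,h^{\varphi}]\mid g,h\in G\rangle\leq\chi(G)$. $\exp(X)$ denotes the exponent of a group $X$. *)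

theory Defs
  imports "HOL-Algebra.Algebra"
begin

definition commutator :: "('a, 'm) monoid_scheme \<Rightarrow> 'a \<Rightarrow> 'a \<Rightarrow> 'a" where
  "commutator G x y = inv\<^bsub>G\<^esub> x \<otimes>\<^bsub>G\<^esub> inv\<^bsub>G\<^esub> y \<otimes>\<^bsub>G\<^esub> x \<otimes>\<^bsub>G\<^esub> y"

text \<open>The exponent is \<open>0\<close> if no positive exponent exists (so that it then divides no positive
  number).\<close>

definition group_exponent :: "('a, 'm) monoid_scheme \<Rightarrow> nat" where
  "group_exponent G =
    (if \<exists>n::nat. n > 0 \<and> (\<forall>x\<in>carrier G. x [^]\<^bsub>G\<^esub> n = \<one>\<^bsub>G\<^esub>)
     then LEAST n. n > 0 \<and> (\<forall>x\<in>carrier G. x [^]\<^bsub>G\<^esub> n = \<one>\<^bsub>G\<^esub>)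
     else 0)"

text \<open>Only meaningful for solvable groups. The library's \<open>derived\<close> uses the commutator convention
  \<open>x y x\<inverse> y\<inverse>\<close>, which generates the same subgroup.\<close>

definition derived_length :: "('a, 'm) monoid_scheme \<Rightarrow> nat" where
  "derived_length G = (LEAST n. (derived G ^^ n) (carrier G) = {\<one>\<^bsub>G\<^esub>})"

definition normal_closure :: "('a, 'm) monoid_scheme \<Rightarrow> 'a set \<Rightarrow> 'a set" where
  "normal_closure G S =
    generate G {g \<otimes>\<^bsub>G\<^esub> s \<otimes>\<^bsub>G\<^esub> inv\<^bsub>G\<^esub> g | g s. g \<in> carrier G \<and> s \<in> S}"

text \<open>Words in the disjoint union of the carriers, modulo the congruence generated by deleting
  identity letters and by multiplying adjacent letters of the same factor.\<close>

definition fp_words :: "('a, 'm) monoid_scheme \<Rightarrow> ('b, 'n) monoid_scheme \<Rightarrow> ('a + 'b) list set" where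
  "fp_words G H = lists (carrier G <+> carrier H)"

inductive_set fp_cong ::
  "('a, 'm) monoid_scheme \<Rightarrow> ('b, 'n) monoid_scheme \<Rightarrow> (('a + 'b) list \<times> ('a + 'b) list) set"
  for G :: "('a, 'm) monoid_scheme" and H :: "('b, 'n) monoid_scheme"
  where
    fp_refl: "u \<in> fp_words G H \<Longrightarrow> (u, u) \<in> fp_cong G H"
  | fp_sym: "(u, v) \<in> fp_cong G H \<Longrightarrow> (v, u) \<in> fp_cong G H"
  | fp_trans: "(u, v) \<in> fp_cong G H \<Longrightarrow> (v, w) \<in> fp_cong G H \<Longrightarrow> (u, w) \<in> fp_cong G H"
  | fp_one_left: "u \<in> fp_words G H \<Longrightarrow> v \<in> fp_words G H \<Longrightarrow>
      (u @ [Inl \<one>\<^bsub>G\<^esub>] @ v, u @ v) \<in> fp_cong G H"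
  | fp_one_right: "u \<in> fp_words G H \<Longrightarrow> v \<in> fp_words G H \<Longrightarrow>
      (u @ [Inr \<one>\<^bsub>H\<^esub>] @ v, u @ v) \<in> fp_cong G H"
  | fp_mult_left: "u \<in> fp_words G H \<Longrightarrow> v \<in> fp_words G H \<Longrightarrow> x \<in> carrier G \<Longrightarrow> y \<in> carrier G \<Longrightarrow>
      (u @ [Inl x, Inl y] @ v, u @ [Inl (x \<otimes>\<^bsub>G\<^esub> y)] @ v) \<in> fp_cong G H"
  | fp_mult_right: "u \<in> fp_words G H \<Longrightarrow> v \<in> fp_words G H \<Longrightarrow> x \<in> carrier H \<Longrightarrow> y \<in> carrier H \<Longrightarrow>
      (u @ [Inr x, Inr y] @ v, u @ [Inr (x \<otimes>\<^bsub>H\<^esub> y)] @ v) \<in> fp_cong G H"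

definition free_product ::
  "('a, 'm) monoid_scheme \<Rightarrow> ('b, 'n) monoid_scheme \<Rightarrow> ('a + 'b) list set monoid" where
  "free_product G H =
    \<lparr>carrier = fp_words G H // fp_cong G H,
     monoid.mult = (\<lambda>A B. \<Union>a\<in>A. \<Union>b\<in>B. fp_cong G H `` {a @ b}),
     one = fp_cong G H `` {[]}\<rparr>"

definition fp_left :: "('a, 'm) monoid_scheme \<Rightarrow> ('b, 'n) monoid_scheme \<Rightarrow> 'a \<Rightarrow> ('a + 'b) list set" where
  "fp_left G H x = fp_cong G H `` {[Inl x]}"

definition fp_right :: "('a, 'm) monoid_scheme \<Rightarrow> ('b, 'n) monoid_scheme \<Rightarrow> 'b \<Rightarrow> ('a + 'b) list set" where
  "fp_right G H y = fp_cong G H `` {[Inr y]}"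

text \<open>The disjoint copy of \<open>G\<close> is the second factor of the free product of \<open>G\<close> with itself, so that
  the isomorphism onto the copy is \<open>fp_right G G\<close>.\<close>

definition wc_relators :: "('a, 'm) monoid_scheme \<Rightarrow> ('a + 'a) list set set" where
  "wc_relators G =
    {commutator (free_product G G) (fp_left G G g) (fp_right G G g) | g. g \<in> carrier G}"

definition wc_kernel :: "('a, 'm) monoid_scheme \<Rightarrow> ('a + 'a) list set set" where
  "wc_kernel G = normal_closure (free_product G G) (wc_relators G)"

definition weak_comm :: "('a, 'm) monoid_scheme \<Rightarrow> ('a + 'a) list set set monoid" where
  "weak_comm G = free_product G G Mod wc_kernel G"

text \<open>The images in \<open>weak_comm G\<close> of \<open>g\<close> and of its copy.\<close>

definition wc_base :: "('a, 'm) monoid_scheme \<Rightarrow> 'a \<Rightarrow> ('a + 'a) list set set" where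
  "wc_base G g = wc_kernel G #>\<^bsub>free_product G G\<^esub> fp_left G G g"

definition wc_copy :: "('a, 'm) monoid_scheme \<Rightarrow> 'a \<Rightarrow> ('a + 'a) list set set" where
  "wc_copy G g = wc_kernel G #>\<^bsub>free_product G G\<^esub> fp_right G G g"

definition D_subgroup :: "('a, 'm) monoid_scheme \<Rightarrow> ('a + 'a) list set set set" where
  "D_subgroup G =
    generate (weak_comm G)
      {commutator (weak_comm G) (wc_base G g) (wc_copy G h) | g h. g \<in> carrier G \<and> h \<in> carrier G}"

definition D_group :: "('a, 'm) monoid_scheme \<Rightarrow> ('a + 'a) list set set monoid" where
  "D_group G = (weak_comm G)\<lparr>carrier := D_subgroup G\<rparr>"

lemma (in group) normal_closure_normal:
  assumes "S \<subseteq> carrier G"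
  shows "normal_closure G S \<lhd> G"
  unfolding normal_closure_def
proof (rule normal_generateI)
  show "{g \<otimes> s \<otimes> inv g |g s. g \<in> carrier G \<and> s \<in> S} \<subseteq> carrier G"
    using assms by auto
next
  fix h g
  assume "h \<in> {g \<otimes> s \<otimes> inv g |g s. g \<in> carrier G \<and> s \<in> S}" and g: "g \<in> carrier G"
  then obtain k s where k: "k \<in> carrier G" "s \<in> S" "h = k \<otimes> s \<otimes> inv k" by auto
  then have "g \<otimes> h \<otimes> inv g = (g \<otimes> k) \<otimes> s \<otimes> inv (g \<otimes> k)"
    using g assms by (auto simp: m_assoc inv_mult_group subset_iff)
  then show "g \<otimes> h \<otimes> inv g \<in> {g \<otimes> s \<otimes> inv g |g s. g \<in> carrier G \<and> s \<in> S}"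
    using k g by blast
qed

lemma fp_words_simps [simp]:
  "[] \<in> fp_words G H"
  "Inl x # u \<in> fp_words G H \<longleftrightarrow> x \<in> carrier G \<and> u \<in> fp_words G H"
  "Inr y # u \<in> fp_words G H \<longleftrightarrow> y \<in> carrier H \<and> u \<in> fp_words G H"
  "u @ v \<in> fp_words G H \<longleftrightarrow> u \<in> fp_words G H \<and> v \<in> fp_words G H"
  by (auto simp: fp_words_def)

lemma fp_cong_words:
  assumes "group G" "group H" "(u, v) \<in> fp_cong G H"
  shows "u \<in> fp_words G H \<and> v \<in> fp_words G H"
proof -
  interpret G: group G by fact
  interpret H: group H by fact
  show ?thesis using assms(3) by induction auto
qed

lemma fp_cong_equiv:
  assumes "group G" "group H"
  shows "equiv (fp_words G H) (fp_cong G H)"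
  using fp_cong_words[OF assms]
  by (intro equivI refl_onI symI transI) (auto intro: fp_refl fp_sym fp_trans)

lemma fp_cong_context:
  assumes "(u, v) \<in> fp_cong G H" "a \<in> fp_words G H" "b \<in> fp_words G H"
  shows "(a @ u @ b, a @ v @ b) \<in> fp_cong G H"
  using assms
proof induction
  case (fp_refl u)
  then show ?case by (intro fp_cong.fp_refl) auto
next
  case (fp_sym u v)
  then show ?case by (auto intro: fp_cong.fp_sym)
next
  case (fp_trans u v w)
  then show ?case by (blast intro: fp_cong.fp_trans)
next
  case (fp_one_left u v)
  then show ?case using fp_cong.fp_one_left[of "a @ u" G H "v @ b"] by simp
next
  case (fp_one_right u v)
  then show ?case using fp_cong.fp_one_right[of "a @ u" G H "v @ b"] by simp
next
  case (fp_mult_left u v x y)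
  then show ?case using fp_cong.fp_mult_left[of "a @ u" G H "v @ b" x y] by simp
next
  case (fp_mult_right u v x y)
  then show ?case using fp_cong.fp_mult_right[of "a @ u" G H "v @ b" x y] by simp
qed

lemma fp_cong_append:
  assumes "group G" "group H" "(u, u') \<in> fp_cong G H" "(v, v') \<in> fp_cong G H"
  shows "(u @ v, u' @ v') \<in> fp_cong G H"
proof -
  have w: "u \<in> fp_words G H" "u' \<in> fp_words G H" "v \<in> fp_words G H" "v' \<in> fp_words G H"
    using fp_cong_words[OF assms(1,2)] assms(3,4) by auto
  have "(u @ v, u' @ v) \<in> fp_cong G H"
    using fp_cong_context[OF assms(3), of "[]" v] w by simp
  moreover have "(u' @ v, u' @ v') \<in> fp_cong G H"
    using fp_cong_context[OF assms(4), of u' "[]"] w by simp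
  ultimately show ?thesis by (rule fp_trans)
qed

lemma fp_mult_class:
  assumes "group G" "group H" "u \<in> fp_words G H" "v \<in> fp_words G H"
  shows "fp_cong G H `` {u} \<otimes>\<^bsub>free_product G H\<^esub> fp_cong G H `` {v} = fp_cong G H `` {u @ v}"
proof -
  have "(\<lambda>a b. fp_cong G H `` {a @ b}) respects2 fp_cong G H"
    using fp_cong_append[OF assms(1,2)] fp_cong_equiv[OF assms(1,2)]
    by (intro congruent2I') (auto intro!: equiv_class_eq)
  then show ?thesis
    using UN_equiv_class2[OF fp_cong_equiv[OF assms(1,2)] fp_cong_equiv[OF assms(1,2)]] assms(3,4)
    by (simp add: free_product_def)
qed

lemma fp_carrierE:
  assumes "A \<in> carrier (free_product G H)"
  obtains u where "u \<in> fp_words G H" "A = fp_cong G H `` {u}"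
  using assms by (auto simp: free_product_def quotient_def)

lemma fp_class_carrier: "u \<in> fp_words G H \<Longrightarrow> fp_cong G H `` {u} \<in> carrier (free_product G H)"
  by (auto simp: free_product_def quotient_def)

lemma fp_one: "\<one>\<^bsub>free_product G H\<^esub> = fp_cong G H `` {[]}"
  by (simp add: free_product_def)

lemma fp_word_inverse:
  assumes "group G" "group H" "u \<in> fp_words G H"
  shows "\<exists>v\<in>fp_words G H. (v @ u, []) \<in> fp_cong G H"
proof -
  interpret G: group G by fact
  interpret H: group H by fact
  show ?thesis using assms(3)
  proof (induction u)
    case Nil
    then show ?case by (auto intro!: bexI[of _ "[]"] fp_refl)
  next
    case (Cons s u)
    show ?case
    proof (cases s)
      case (Inl x)
      with Cons obtain v where v: "v \<in> fp_words G H" "(v @ u, []) \<in> fp_cong G H"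
        and u: "u \<in> fp_words G H" and x: "x \<in> carrier G" by auto
      have "(v @ [Inl (inv\<^bsub>G\<^esub> x), Inl x] @ u, v @ [Inl \<one>\<^bsub>G\<^esub>] @ u) \<in> fp_cong G H"
        using fp_mult_left[of v G H u "inv\<^bsub>G\<^esub> x" x] v u x by simp
      then have "((v @ [Inl (inv\<^bsub>G\<^esub> x)]) @ s # u, []) \<in> fp_cong G H"
        using fp_one_left[of v G H u] v u Inl by (auto intro: fp_trans)
      then show ?thesis using v x by (intro bexI[of _ "v @ [Inl (inv\<^bsub>G\<^esub> x)]"]) auto
    next
      case (Inr x)
      with Cons obtain v where v: "v \<in> fp_words G H" "(v @ u, []) \<in> fp_cong G H"
        and u: "u \<in> fp_words G H" and x: "x \<in> carrier H" by auto
      have "(v @ [Inr (inv\<^bsub>H\<^esub> x), Inr x] @ u, v @ [Inr \<one>\<^bsub>H\<^esub>] @ u) \<in> fp_cong G H"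
        using fp_mult_right[of v G H u "inv\<^bsub>H\<^esub> x" x] v u x by simp
      then have "((v @ [Inr (inv\<^bsub>H\<^esub> x)]) @ s # u, []) \<in> fp_cong G H"
        using fp_one_right[of v G H u] v u Inr by (auto intro: fp_trans)
      then show ?thesis using v x by (intro bexI[of _ "v @ [Inr (inv\<^bsub>H\<^esub> x)]"]) auto
    qed
  qed
qed

lemma group_free_product:
  assumes "group G" "group H"
  shows "group (free_product G H)"
proof (rule groupI)
  fix A B assume "A \<in> carrier (free_product G H)" "B \<in> carrier (free_product G H)"
  then show "A \<otimes>\<^bsub>free_product G H\<^esub> B \<in> carrier (free_product G H)"
    by (auto elim!: fp_carrierE simp: fp_mult_class[OF assms] intro!: fp_class_carrier)
next
  show "\<one>\<^bsub>free_product G H\<^esub> \<in> carrier (free_product G H)"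
    by (simp add: fp_one fp_class_carrier)
next
  fix A B C
  assume "A \<in> carrier (free_product G H)" "B \<in> carrier (free_product G H)"
    "C \<in> carrier (free_product G H)"
  then show "A \<otimes>\<^bsub>free_product G H\<^esub> B \<otimes>\<^bsub>free_product G H\<^esub> C =
      A \<otimes>\<^bsub>free_product G H\<^esub> (B \<otimes>\<^bsub>free_product G H\<^esub> C)"
    by (auto elim!: fp_carrierE simp: fp_mult_class[OF assms])
next
  fix A assume "A \<in> carrier (free_product G H)"
  then show "\<one>\<^bsub>free_product G H\<^esub> \<otimes>\<^bsub>free_product G H\<^esub> A = A"
    by (auto elim!: fp_carrierE simp: fp_mult_class[OF assms] fp_one)
next
  fix A assume "A \<in> carrier (free_product G H)"
  then obtain u where u: "u \<in> fp_words G H" "A = fp_cong G H `` {u}" by (rule fp_carrierE)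
  obtain v where v: "v \<in> fp_words G H" "(v @ u, []) \<in> fp_cong G H"
    using fp_word_inverse[OF assms u(1)] by auto
  then have "fp_cong G H `` {v} \<otimes>\<^bsub>free_product G H\<^esub> A = \<one>\<^bsub>free_product G H\<^esub>"
    using u equiv_class_eq[OF fp_cong_equiv[OF assms]] by (simp add: fp_mult_class[OF assms] fp_one)
  then show "\<exists>B\<in>carrier (free_product G H). B \<otimes>\<^bsub>free_product G H\<^esub> A = \<one>\<^bsub>free_product G H\<^esub>"
    using fp_class_carrier[OF v(1)] by blast
qed

lemma fp_left_hom:
  assumes "group G" "group H"
  shows "fp_left G H \<in> hom G (free_product G H)"
proof (rule homI)
  fix x assume "x \<in> carrier G"
  then show "fp_left G H x \<in> carrier (free_product G H)"
    unfolding fp_left_def by (intro fp_class_carrier) simp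
next
  fix x y assume "x \<in> carrier G" "y \<in> carrier G"
  then show "fp_left G H (x \<otimes>\<^bsub>G\<^esub> y) = fp_left G H x \<otimes>\<^bsub>free_product G H\<^esub> fp_left G H y"
    using equiv_class_eq[OF fp_cong_equiv[OF assms] fp_mult_left[of "[]" G H "[]" x y]]
    by (simp add: fp_left_def fp_mult_class[OF assms])
qed

lemma fp_right_hom:
  assumes "group G" "group H"
  shows "fp_right G H \<in> hom H (free_product G H)"
proof (rule homI)
  fix x assume "x \<in> carrier H"
  then show "fp_right G H x \<in> carrier (free_product G H)"
    unfolding fp_right_def by (intro fp_class_carrier) simp
next
  fix x y assume "x \<in> carrier H" "y \<in> carrier H"
  then show "fp_right G H (x \<otimes>\<^bsub>H\<^esub> y) = fp_right G H x \<otimes>\<^bsub>free_product G H\<^esub> fp_right G H y"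
    using equiv_class_eq[OF fp_cong_equiv[OF assms] fp_mult_right[of "[]" G H "[]" x y]]
    by (simp add: fp_right_def fp_mult_class[OF assms])
qed

lemma free_product_universal:
  assumes "group G" "group H" "group K" and f: "f \<in> hom G K" and g: "g \<in> hom H K"
  shows "\<exists>h\<in>hom (free_product G H) K.
    (\<forall>x\<in>carrier G. h (fp_left G H x) = f x) \<and> (\<forall>y\<in>carrier H. h (fp_right G H y) = g y)"
proof -
  interpret G: group G by fact
  interpret H: group H by fact
  interpret K: group K by fact
  interpret f: group_hom G K f by unfold_locales (rule f)
  interpret g: group_hom H K g by unfold_locales (rule g)
  define ev where "ev w = foldr (\<lambda>s z. case_sum f g s \<otimes>\<^bsub>K\<^esub> z) w \<one>\<^bsub>K\<^esub>" for w
  have ev_simps [simp]: "ev [] = \<one>\<^bsub>K\<^esub>" "ev (Inl x # w) = f x \<otimes>\<^bsub>K\<^esub> ev w"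
    "ev (Inr y # w) = g y \<otimes>\<^bsub>K\<^esub> ev w" for x y w
    by (simp_all add: ev_def)
  have ev_closed [simp]: "w \<in> fp_words G H \<Longrightarrow> ev w \<in> carrier K" for w
  proof (induction w)
    case (Cons s w)
    then show ?case by (cases s) auto
  qed auto
  have ev_append: "u \<in> fp_words G H \<Longrightarrow> v \<in> fp_words G H \<Longrightarrow> ev (u @ v) = ev u \<otimes>\<^bsub>K\<^esub> ev v" for u v
  proof (induction u)
    case (Cons s u)
    then show ?case by (cases s) (auto simp: K.m_assoc)
  qed auto
  have ev_cong: "(u, v) \<in> fp_cong G H \<Longrightarrow> ev u = ev v" for u v
    by (induction rule: fp_cong.induct) (auto simp: ev_append K.m_assoc)
  define h where "h A = (THE z. \<exists>w\<in>A. z = ev w)" for A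
  have h_class: "h (fp_cong G H `` {w}) = ev w" if w: "w \<in> fp_words G H" for w
    unfolding h_def
  proof (rule the_equality)
    show "\<exists>v\<in>fp_cong G H `` {w}. ev w = ev v" using fp_refl[OF w] by blast
  next
    fix z assume "\<exists>v\<in>fp_cong G H `` {w}. z = ev v"
    then show "z = ev w" using ev_cong by (metis Image_singleton_iff)
  qed
  have "h \<in> hom (free_product G H) K"
    by (rule homI) (auto elim!: fp_carrierE
        simp: fp_mult_class[OF assms(1,2)] h_class ev_append)
  moreover have "\<forall>x\<in>carrier G. h (fp_left G H x) = f x" "\<forall>y\<in>carrier H. h (fp_right G H y) = g y"
    by (auto simp: fp_left_def fp_right_def h_class)
  ultimately show ?thesis by blast
qed

lemma wc_relators_carrier:
  assumes "group G"
  shows "wc_relators G \<subseteq> carrier (free_product G G)"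
proof -
  interpret F: group "free_product G G" by (rule group_free_product[OF assms assms])
  show ?thesis
    using hom_in_carrier[OF fp_left_hom[OF assms assms]] hom_in_carrier[OF fp_right_hom[OF assms assms]]
    by (auto simp: wc_relators_def commutator_def)
qed

lemma wc_kernel_normal:
  assumes "group G"
  shows "wc_kernel G \<lhd> free_product G G"
  unfolding wc_kernel_def
  by (rule group.normal_closure_normal[OF group_free_product[OF assms assms]
        wc_relators_carrier[OF assms]])

lemma group_weak_comm:
  assumes "group G"
  shows "group (weak_comm G)"
  unfolding weak_comm_def by (rule normal.factorgroup_is_group[OF wc_kernel_normal[OF assms]])

lemma wc_base_hom:
  assumes "group G"
  shows "wc_base G \<in> hom G (weak_comm G)"
  using hom_compose[OF fp_left_hom[OF assms assms] normal.r_coset_hom_Mod[OF wc_kernel_normal[OF assms]]]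
  by (simp add: weak_comm_def wc_base_def[abs_def] comp_def)

lemma wc_copy_hom:
  assumes "group G"
  shows "wc_copy G \<in> hom G (weak_comm G)"
  using hom_compose[OF fp_right_hom[OF assms assms] normal.r_coset_hom_Mod[OF wc_kernel_normal[OF assms]]]
  by (simp add: weak_comm_def wc_copy_def[abs_def] comp_def)

text \<open>The universal property of \<open>weak_comm G\<close>; for \<open>f = g = id\<close> it shows that \<open>G\<close> and its copy embed.\<close>

lemma weak_comm_universal:
  assumes "group G" "group K" and f: "f \<in> hom G K" and g: "g \<in> hom G K"
    and comm: "\<And>x. x \<in> carrier G \<Longrightarrow> commutator K (f x) (g x) = \<one>\<^bsub>K\<^esub>"
  shows "\<exists>h\<in>hom (weak_comm G) K.
    \<forall>x\<in>carrier G. h (wc_base G x) = f x \<and> h (wc_copy G x) = g x"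
proof -
  let ?F = "free_product G G"
  have F: "group ?F" by (rule group_free_product[OF assms(1,1)])
  obtain h where h: "h \<in> hom ?F K"
    and hl: "\<And>x. x \<in> carrier G \<Longrightarrow> h (fp_left G G x) = f x"
    and hr: "\<And>x. x \<in> carrier G \<Longrightarrow> h (fp_right G G x) = g x"
    using free_product_universal[OF assms(1,1,2) f g] by blast
  interpret F: group ?F by (rule F)
  interpret K: group K by fact
  interpret h: group_hom ?F K h by unfold_locales (rule h)
  have l: "fp_left G G x \<in> carrier ?F" and r: "fp_right G G x \<in> carrier ?F" if "x \<in> carrier G" for x
    using that hom_in_carrier[OF fp_left_hom[OF assms(1,1)]] hom_in_carrier[OF fp_right_hom[OF assms(1,1)]]
    by auto
  have "wc_relators G \<subseteq> kernel ?F K h"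
    using comm l r by (auto simp: wc_relators_def kernel_def commutator_def hl hr)
  then have "{a \<otimes>\<^bsub>?F\<^esub> s \<otimes>\<^bsub>?F\<^esub> inv\<^bsub>?F\<^esub> a | a s. a \<in> carrier ?F \<and> s \<in> wc_relators G} \<subseteq> kernel ?F K h"
    by (auto simp: kernel_def subset_iff)
  then have "wc_kernel G \<subseteq> kernel ?F K h"
    unfolding wc_kernel_def normal_closure_def
    by (rule F.generate_subgroup_incl) (rule h.subgroup_kernel)
  then obtain k where k: "k \<in> hom (?F Mod wc_kernel G) K"
    "\<And>x. x \<in> carrier ?F \<Longrightarrow> k (wc_kernel G #>\<^bsub>?F\<^esub> x) = h x"
    using h.FactGroup_universal_kernel[OF wc_kernel_normal[OF assms(1)]] by metis
  then show ?thesis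
    unfolding weak_comm_def wc_base_def wc_copy_def using l r hl hr by (intro bexI[of _ k]) auto
qed

lemma wc_embeddings_inj:
  assumes "group G"
  shows "inj_on (wc_base G) (carrier G)" "inj_on (wc_copy G) (carrier G)"
proof -
  interpret group G by fact
  have "commutator G (id x) (id x) = \<one>\<^bsub>G\<^esub>" if "x \<in> carrier G" for x
    using that by (simp add: commutator_def m_assoc)
  then obtain h where "\<forall>x\<in>carrier G. h (wc_base G x) = x \<and> h (wc_copy G x) = x"
    using weak_comm_universal[OF assms assms, of id id] by (auto simp: hom_def)
  then show "inj_on (wc_base G) (carrier G)" "inj_on (wc_copy G) (carrier G)"
    by (auto intro: inj_on_inverseI[of _ h])
qed

lemma D_subgroup_is_subgroup:
  assumes "group G"
  shows "subgroup (D_subgroup G) (weak_comm G)"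
proof -
  interpret X: group "weak_comm G" by (rule group_weak_comm[OF assms])
  show ?thesis unfolding D_subgroup_def
    using hom_in_carrier[OF wc_base_hom[OF assms]] hom_in_carrier[OF wc_copy_hom[OF assms]]
    by (intro X.generate_is_subgroup) (auto simp: commutator_def)
qed

end

theory Submission
  imports Defs
begin

text \<open>
  Put \<open>d a b = [a, b\<^sup>\<phi>]\<close>. Expanding the relation for \<open>a b\<inverse>\<close> gives \<open>d a b = (d b a)\<inverse>\<close>, and from this
  \<open>k\<close> and \<open>k\<^sup>\<phi>\<close> induce the same automorphism of \<open>D(G)\<close>; in particular \<open>d a b\<close> acts on \<open>D(G)\<close>
  as \<open>[a, b]\<close> does. For a normal subgroup \<open>M\<close> of \<open>G\<close> let \<open>D M\<close> be the subgroup generated by the \<open>d m a\<close>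
  with \<open>m \<in> M\<close>; it is normal in \<open>\<chi>(G)\<close>. Modulo \<open>D [M, M]\<close> the image of \<open>[M, M]\<close> centralises \<open>D(G)\<close>,
  so that \<open>D M\<close> has class at most 2 and its \<open>n\<close>-th powers are central, where \<open>n = exp(G)\<close>. Moreover
  \<open>d (m\<^sup>i) a = c\<^bsup>i(i-1)/2\<^esup> (d m a)\<^sup>i\<close> with the central element \<open>c = d m [a, m]\<close> of exponent \<open>n\<close>.
  Hence \<open>x\<^sup>e \<in> D [M, M]\<close> for all \<open>x \<in> D M\<close> whenever \<open>n\<close> divides both \<open>e\<close> and \<open>e(e-1)/2\<close>: take \<open>e = n\<close> for
  odd \<open>n\<close> and \<open>e = 2 n\<close> otherwise. If \<open>M = G\<close>, then \<open>e = n\<close> always suffices, because \<open>D M\<close> is abelian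
  and \<open>c\<close> trivial modulo \<open>D [G, G]\<close>. Running down the derived series bounds the exponent of \<open>D(G)\<close>,
  and \<open>\<chi>(G)/D(G)\<close> is generated by two commuting images of \<open>G\<close>.
\<close>

section \<open>Conjugates, commutators and exponents\<close>

context group
begin

lemma cancel_left:
  "x \<in> carrier G \<Longrightarrow> y \<in> carrier G \<Longrightarrow> inv x \<otimes> (x \<otimes> y) = y"
  "x \<in> carrier G \<Longrightarrow> y \<in> carrier G \<Longrightarrow> x \<otimes> (inv x \<otimes> y) = y"
  by (simp_all add: m_assoc[symmetric])

lemmas word_simps = m_assoc inv_mult_group cancel_left

lemma commutator_closed [simp, intro]:
  "x \<in> carrier G \<Longrightarrow> y \<in> carrier G \<Longrightarrow> commutator G x y \<in> carrier G"
  by (simp add: commutator_def)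

text \<open>A right action, so that a product, and in particular a commutator, acts by its letters
  read from left to right.\<close>

definition conjugate :: "'a \<Rightarrow> 'a \<Rightarrow> 'a" where
  "conjugate x y = inv y \<otimes> x \<otimes> y"

lemma conjugate_closed [simp]: "x \<in> carrier G \<Longrightarrow> y \<in> carrier G \<Longrightarrow> conjugate x y \<in> carrier G"
  and one_conjugate [simp]: "y \<in> carrier G \<Longrightarrow> conjugate \<one> y = \<one>"
  and conjugate_one [simp]: "x \<in> carrier G \<Longrightarrow> conjugate x \<one> = x"
  by (simp_all add: conjugate_def)

lemma conjugate_mult:
  assumes "x \<in> carrier G" "y \<in> carrier G" "z \<in> carrier G"
  shows "conjugate (x \<otimes> y) z = conjugate x z \<otimes> conjugate y z"
  using assms by (simp add: conjugate_def word_simps)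

lemma conjugate_inv:
  assumes "x \<in> carrier G" "z \<in> carrier G"
  shows "conjugate (inv x) z = inv (conjugate x z)"
  using assms by (simp add: conjugate_def word_simps)

lemma conjugate_pow:
  assumes "x \<in> carrier G" "z \<in> carrier G"
  shows "conjugate (x [^] (n::nat)) z = conjugate x z [^] n"
  using assms by (induction n) (simp_all add: conjugate_mult)

lemma conjugate_conjugate:
  assumes "x \<in> carrier G" "y \<in> carrier G" "z \<in> carrier G"
  shows "conjugate (conjugate x y) z = conjugate x (y \<otimes> z)"
  using assms by (simp add: conjugate_def word_simps)

lemma conjugate_eq_iff:
  assumes "x \<in> carrier G" "y \<in> carrier G" "z \<in> carrier G"
  shows "conjugate x y = z \<longleftrightarrow> x \<otimes> y = y \<otimes> z"
  unfolding conjugate_def using assms inv_solve_left[of z y "x \<otimes> y"]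
  by (auto simp: word_simps)

lemma commutator_commutes:
  assumes "x \<in> carrier G" "y \<in> carrier G"
  shows "y \<otimes> x \<otimes> commutator G x y = x \<otimes> y"
  using assms by (simp add: commutator_def word_simps)

lemma commutator_one_iff:
  assumes "x \<in> carrier G" "y \<in> carrier G"
  shows "commutator G x y = \<one> \<longleftrightarrow> x \<otimes> y = y \<otimes> x"
  using commutator_commutes[OF assms] assms
  by (metis commutator_closed l_cancel_one' m_closed r_cancel_one)

lemma inv_commutator:
  assumes "x \<in> carrier G" "y \<in> carrier G"
  shows "inv (commutator G x y) = commutator G y x"
  using assms by (simp add: commutator_def word_simps)

text \<open>Multiplying \<open>eq\<close> on the left by the inverse of \<open>x y = y x\<close> and
  on the right by that of \<open>p q = q p\<close> leaves one commutator on each side.\<close>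

lemma commutators_eqI:
  assumes "x \<in> carrier G" "y \<in> carrier G" "p \<in> carrier G" "q \<in> carrier G"
    and xy: "x \<otimes> y = y \<otimes> x" and pq: "p \<otimes> q = q \<otimes> p"
    and eq: "x \<otimes> p \<otimes> (y \<otimes> q) = y \<otimes> q \<otimes> (x \<otimes> p)"
  shows "commutator G y (inv p) = commutator G x (inv q)"
proof -
  have "inv y \<otimes> p \<otimes> y \<otimes> q = inv (x \<otimes> y) \<otimes> (x \<otimes> p \<otimes> (y \<otimes> q))"
    using assms(1-4) by (simp add: word_simps)
  also have "\<dots> = inv x \<otimes> q \<otimes> x \<otimes> p"
    unfolding eq xy using assms(1-4) by (simp add: word_simps)
  finally have "inv y \<otimes> p \<otimes> y \<otimes> q \<otimes> inv (p \<otimes> q) = inv x \<otimes> q \<otimes> x \<otimes> p \<otimes> inv (q \<otimes> p)"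
    using pq by simp
  then show ?thesis unfolding commutator_def using assms(1-4) by (simp add: word_simps)
qed

text \<open>Collection: each of the \<open>n choose 2\<close> transpositions of a \<open>y\<close>
  past an \<open>x\<close> leaves one \<open>z\<close>, which commutes with both. The first formula
  exhibits \<open>z [^] n\<close> as the commutator of \<open>y [^] n\<close> and
  \<open>x\<close>.\<close>

lemma pow_mult_central_commutator:
  assumes x: "x \<in> carrier G" and y: "y \<in> carrier G" and z: "z \<in> carrier G"
    and yx: "y \<otimes> x = x \<otimes> y \<otimes> z" and xz: "x \<otimes> z = z \<otimes> x" and yz: "y \<otimes> z = z \<otimes> y"
  shows "y [^] (n::nat) \<otimes> x = x \<otimes> y [^] n \<otimes> z [^] n"
    and "(x \<otimes> y) [^] n = x [^] n \<otimes> y [^] n \<otimes> z [^] (n choose 2)"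
proof -
  have zy: "z [^] k \<otimes> y = y \<otimes> z [^] k" for k :: nat
    by (rule group_commutes_pow[OF yz[symmetric] z y])
  have *: "y [^] n \<otimes> x = x \<otimes> y [^] n \<otimes> z [^] n" for n :: nat
  proof (induction n)
    case (Suc n)
    have "y [^] Suc n \<otimes> x = y [^] n \<otimes> (y \<otimes> x)" using x y by (simp add: m_assoc)
    also have "\<dots> = (y [^] n \<otimes> x) \<otimes> y \<otimes> z" using x y z by (simp add: yx m_assoc)
    also have "\<dots> = x \<otimes> y [^] n \<otimes> (z [^] n \<otimes> y) \<otimes> z" using x y z by (simp add: Suc m_assoc)
    also have "\<dots> = x \<otimes> y [^] Suc n \<otimes> z [^] Suc n" using x y z by (simp add: zy m_assoc)
    finally show ?case .
  qed (use x in simp)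
  then show "y [^] n \<otimes> x = x \<otimes> y [^] n \<otimes> z [^] n" .
  show "(x \<otimes> y) [^] n = x [^] n \<otimes> y [^] n \<otimes> z [^] (n choose 2)"
  proof (induction n)
    case (Suc n)
    let ?c = "z [^] (n choose 2)"
    have "z \<otimes> (x \<otimes> y) = x \<otimes> y \<otimes> z" using x y z xz yz by (metis m_assoc)
    then have c: "?c \<otimes> (x \<otimes> y) = x \<otimes> y \<otimes> ?c" using group_commutes_pow z x y by simp
    have "(x \<otimes> y) [^] Suc n = x [^] n \<otimes> y [^] n \<otimes> (?c \<otimes> (x \<otimes> y))"
      using x y z by (simp add: Suc m_assoc)
    also have "\<dots> = x [^] n \<otimes> (y [^] n \<otimes> x) \<otimes> (y \<otimes> ?c)"
      unfolding c using x y z by (simp add: m_assoc)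
    also have "\<dots> = x [^] n \<otimes> x \<otimes> y [^] n \<otimes> (z [^] n \<otimes> y) \<otimes> ?c"
      unfolding * using x y z by (simp add: m_assoc)
    also have "\<dots> = x [^] Suc n \<otimes> y [^] Suc n \<otimes> (z [^] n \<otimes> ?c)"
      unfolding zy using x y z by (simp add: m_assoc)
    also have "z [^] n \<otimes> ?c = z [^] (Suc n choose 2)"
      using z by (simp add: nat_pow_mult numeral_2_eq_2)
    finally show ?case .
  qed (simp add: numeral_2_eq_2)
qed

section \<open>Exponents and divisibility\<close>

lemma pow_dvd_one:
  assumes "x \<in> carrier G" "x [^] (n::nat) = \<one>" "n dvd k"
  shows "x [^] k = \<one>"
  using assms by (metis dvdE nat_pow_one nat_pow_pow)

text \<open>The witness \<open>k\<close> rules out the default value \<open>0\<close>, so that the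
  rules for least elements apply.\<close>

lemma group_exponent_Least:
  fixes j k :: nat
  assumes "k > 0" "\<And>x. x \<in> carrier G \<Longrightarrow> x [^] k = \<one>"
  shows "group_exponent G > 0" and "\<And>x. x \<in> carrier G \<Longrightarrow> x [^] group_exponent G = \<one>"
    and "j > 0 \<Longrightarrow> (\<And>x. x \<in> carrier G \<Longrightarrow> x [^] j = \<one>) \<Longrightarrow> group_exponent G \<le> j"
proof -
  define P where "P n \<longleftrightarrow> n > 0 \<and> (\<forall>x\<in>carrier G. x [^] n = \<one>)" for n :: nat
  have P: "P k" using assms by (simp add: P_def)
  then have "\<exists>n. P n" by (rule exI)
  then have e: "group_exponent G = (LEAST n. P n)"
    unfolding group_exponent_def P_def by (rule if_P)
  have "P (group_exponent G)" unfolding e using P by (rule LeastI)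
  then show "group_exponent G > 0" "\<And>x. x \<in> carrier G \<Longrightarrow> x [^] group_exponent G = \<one>"
    by (simp_all add: P_def)
  assume "j > 0" "\<And>x. x \<in> carrier G \<Longrightarrow> x [^] j = \<one>"
  then have "P j" by (simp add: P_def)
  then show "group_exponent G \<le> j" unfolding e by (rule Least_le)
qed

text \<open>Division with remainder: \<open>k mod ?n\<close> also annihilates every element, so by
  minimality it is \<open>0\<close>.\<close>

lemma group_exponent_dvdI:
  assumes "k > 0" "\<And>x. x \<in> carrier G \<Longrightarrow> x [^] k = \<one>"
  shows "group_exponent G dvd k"
proof -
  let ?n = "group_exponent G"
  have n: "?n > 0" "\<And>x. x \<in> carrier G \<Longrightarrow> x [^] ?n = \<one>"
    using group_exponent_Least[OF assms(1)] assms(2) by blast+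
  have "x [^] (k mod ?n) = \<one>" if x: "x \<in> carrier G" for x
  proof -
    have "x [^] k = x [^] (?n * (k div ?n)) \<otimes> x [^] (k mod ?n)"
      using x by (simp add: nat_pow_mult)
    moreover have "x [^] (?n * (k div ?n)) = \<one>"
      using n(2)[OF x] x by (metis nat_pow_one nat_pow_pow)
    ultimately show ?thesis using x assms(2)[OF x] by simp
  qed
  then have "\<not> 0 < k mod ?n"
    using group_exponent_Least(3)[OF assms(1), of "k mod ?n"] assms(2) mod_less_divisor[OF n(1), of k]
    by fastforce
  then show ?thesis by auto
qed

lemma group_exponent_finite:
  assumes "finite (carrier G)"
  shows "group_exponent G > 0" and "x \<in> carrier G \<Longrightarrow> x [^] group_exponent G = \<one>"
  using assms group_exponent_Least(1,2)[of "order G"] pow_order_eq_1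
  by (simp_all add: order_gt_0_iff_finite)

end

lemma (in group_hom) hom_commutator:
  assumes "x \<in> carrier G" "y \<in> carrier G"
  shows "h (commutator G x y) = commutator H (h x) (h y)"
  using assms by (simp add: commutator_def)

section \<open>Pairs of elementwise commuting homomorphisms\<close>

text \<open>The target \<open>H\<close> is arbitrary rather than the weak commutativity group
  itself, so that the results apply to its quotients as well.\<close>

locale weakly_commuting_homs = G: group G + group H
  for G :: "('a, 'm) monoid_scheme" and H :: "('x, 'n) monoid_scheme" (structure) +
  fixes f g :: "'a \<Rightarrow> 'x"
  assumes f_hom: "f \<in> hom G H" and g_hom: "g \<in> hom G H"
    and commute: "a \<in> carrier G \<Longrightarrow> f a \<otimes> g a = g a \<otimes> f a"

sublocale weakly_commuting_homs \<subseteq> f: group_hom G H f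
  by unfold_locales (rule f_hom)

sublocale weakly_commuting_homs \<subseteq> g: group_hom G H g
  by unfold_locales (rule g_hom)

context weakly_commuting_homs
begin

section \<open>The commutators \<open>d a b\<close> and the subgroups \<open>D M\<close>\<close>

definition d :: "'a \<Rightarrow> 'a \<Rightarrow> 'x" where
  "d a b = commutator H (f a) (g b)"

definition D :: "'a set \<Rightarrow> 'x set" where
  "D M = generate H {d m a | m a. m \<in> M \<and> a \<in> carrier G}"

lemma d_closed [simp, intro]: "a \<in> carrier G \<Longrightarrow> b \<in> carrier G \<Longrightarrow> d a b \<in> carrier H"
  by (simp add: d_def)

lemma d_one [simp]: "a \<in> carrier G \<Longrightarrow> d \<one>\<^bsub>G\<^esub> a = \<one>"
  by (simp add: d_def commutator_def)

lemma d_one_iff: "a \<in> carrier G \<Longrightarrow> b \<in> carrier G \<Longrightarrow> d a b = \<one> \<longleftrightarrow> f a \<otimes> g b = g b \<otimes> f a"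
  by (simp add: d_def commutator_one_iff)

lemma d_mult_left:
  assumes "a \<in> carrier G" "b \<in> carrier G" "c \<in> carrier G"
  shows "d (a \<otimes>\<^bsub>G\<^esub> b) c = conjugate (d a c) (f b) \<otimes> d b c"
  using assms by (simp add: d_def commutator_def conjugate_def word_simps)

lemma d_mult_right:
  assumes "a \<in> carrier G" "b \<in> carrier G" "c \<in> carrier G"
  shows "d a (b \<otimes>\<^bsub>G\<^esub> c) = d a c \<otimes> conjugate (d a b) (g c)"
  using assms by (simp add: d_def commutator_def conjugate_def word_simps)

text \<open>Of the relation for \<open>a\<close> times the inverse of \<open>b\<close>, multiplied
  out, \<open>commutators_eqI\<close> leaves exactly the two mixed commutators. Hence
  \<open>D M\<close> also contains \<open>d a m\<close> for \<open>m\<close> in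
  \<open>M\<close>.\<close>

lemma d_swap:
  assumes a: "a \<in> carrier G" and b: "b \<in> carrier G"
  shows "d a b = inv (d b a)"
proof -
  have "f a \<otimes> inv (f b) \<otimes> (g a \<otimes> inv (g b)) = g a \<otimes> inv (g b) \<otimes> (f a \<otimes> inv (f b))"
    using commute[of "a \<otimes>\<^bsub>G\<^esub> inv\<^bsub>G\<^esub> b"] a b by simp
  moreover have "inv (f b) \<otimes> inv (g b) = inv (g b) \<otimes> inv (f b)"
    using commute[of "inv\<^bsub>G\<^esub> b"] b by simp
  ultimately have "commutator H (g a) (f b) = commutator H (f a) (g b)"
    using commutators_eqI[of "f a" "g a" "inv (f b)" "inv (g b)"] commute[OF a] a b by simp
  then show ?thesis using a b by (simp add: d_def inv_commutator)
qed

text \<open>\<open>d a (b c)\<close> is expanded twice: directly, which conjugates by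
  \<open>g c\<close>, and after \<open>d_swap\<close>, which conjugates by \<open>f c\<close>. Then
  \<open>d a c\<close> cancels.\<close>

lemma conjugate_d:
  assumes "a \<in> carrier G" "b \<in> carrier G" "c \<in> carrier G"
  shows "conjugate (d a b) (g c) = conjugate (d a b) (f c)"
proof -
  have "d a c \<otimes> conjugate (d a b) (g c) = d a (b \<otimes>\<^bsub>G\<^esub> c)"
    using assms by (simp add: d_mult_right)
  also have "\<dots> = inv (conjugate (d b a) (f c) \<otimes> d c a)"
    using assms d_swap[of a "b \<otimes>\<^bsub>G\<^esub> c"] by (simp add: d_mult_left)
  also have "\<dots> = d a c \<otimes> conjugate (d a b) (f c)"
    using assms d_swap[of a c] d_swap[of a b] by (simp add: inv_mult_group conjugate_inv)
  finally show ?thesis using assms by simp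
qed

lemma D_generators: "M \<subseteq> carrier G \<Longrightarrow> {d m a | m a. m \<in> M \<and> a \<in> carrier G} \<subseteq> carrier H"
  by auto

lemma D_subgroup: "M \<subseteq> carrier G \<Longrightarrow> subgroup (D M) H"
  unfolding D_def by (intro generate_is_subgroup D_generators)

lemma D_subset: "M \<subseteq> carrier G \<Longrightarrow> D M \<subseteq> carrier H"
  using D_subgroup subgroup.subset by blast

lemma D_mono: "M \<subseteq> M' \<Longrightarrow> D M \<subseteq> D M'"
  unfolding D_def by (rule mono_generate) auto

lemma d_in_D: "m \<in> M \<Longrightarrow> a \<in> carrier G \<Longrightarrow> d m a \<in> D M"
  unfolding D_def by (rule generate.incl) auto

lemma D_one: "D {\<one>\<^bsub>G\<^esub>} = {\<one>}"
proof -
  have "{d m a | m a. m \<in> {\<one>\<^bsub>G\<^esub>} \<and> a \<in> carrier G} = {\<one>}" by (auto intro!: exI[of _ "\<one>\<^bsub>G\<^esub>"])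
  then show ?thesis by (simp add: D_def generate_one)
qed

text \<open>Unlike in \<open>generate.induct\<close>, the inversion step covers all of
  \<open>D M\<close>, so that inverses of generators need no computation of their own.\<close>

lemma D_induct [consumes 2, case_names gen one inv mult]:
  assumes "x \<in> D M" "M \<subseteq> carrier G"
    and gen: "\<And>m a. m \<in> M \<Longrightarrow> a \<in> carrier G \<Longrightarrow> P (d m a)"
    and one: "P \<one>"
    and inv: "\<And>x. x \<in> D M \<Longrightarrow> P x \<Longrightarrow> P (inv x)"
    and mult: "\<And>x y. x \<in> D M \<Longrightarrow> y \<in> D M \<Longrightarrow> P x \<Longrightarrow> P y \<Longrightarrow> P (x \<otimes> y)"
  shows "P x"
  using assms(1) unfolding D_def
proof (induction rule: generate.induct)
  case (inv h)
  then obtain m a where "h = d m a" "m \<in> M" "a \<in> carrier G" by auto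
  then show ?case using gen assms(4) assms(5)[of h] d_in_D by auto
next
  case (eng x y)
  then show ?case using mult by (simp add: D_def)
qed (use gen one in auto)

section \<open>The action of the two images on \<open>D(G)\<close>\<close>

lemma conjugate_D:
  assumes "x \<in> D (carrier G)" "c \<in> carrier G"
  shows "conjugate x (g c) = conjugate x (f c)"
  using assms(1) subset_refl[of "carrier G"]
proof (induction rule: D_induct)
  case (inv x)
  then show ?case using assms(2) D_subset[of "carrier G"] by (auto simp: conjugate_inv)
next
  case (mult x y)
  then show ?case using assms(2) D_subset[of "carrier G"] by (auto simp: conjugate_mult subset_iff)
qed (use assms(2) conjugate_d in auto)

text \<open>The product rule for \<open>d m (a c)\<close>, solved for its conjugated factor,
  expresses the conjugate of a generator by two generators. This is why the second argument in
  \<open>D M\<close> runs through all of \<open>G\<close>.\<close>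

lemma conjugate_D_closed:
  assumes "x \<in> D M" "M \<subseteq> carrier G" "c \<in> carrier G"
  shows "conjugate x (f c) \<in> D M"
  using assms(1,2)
proof (induction rule: D_induct)
  case (gen m a)
  then have m: "m \<in> carrier G" using assms by auto
  have "d m (a \<otimes>\<^bsub>G\<^esub> c) = d m c \<otimes> conjugate (d m a) (f c)"
    using gen m assms(3) by (simp add: d_mult_right conjugate_d)
  then have "conjugate (d m a) (f c) = inv (d m c) \<otimes> d m (a \<otimes>\<^bsub>G\<^esub> c)"
    using gen m assms(3) by (simp add: cancel_left)
  then show ?case
    using gen assms(3) subgroup.m_closed[OF D_subgroup[OF assms(2)]]
      subgroup.m_inv_closed[OF D_subgroup[OF assms(2)]] d_in_D by auto
next
  case one
  then show ?case using assms subgroup.one_closed[OF D_subgroup[OF assms(2)]] by simp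
next
  case (inv x)
  then show ?case using assms D_subset[OF assms(2)] subgroup.m_inv_closed[OF D_subgroup[OF assms(2)]]
    by (auto simp: conjugate_inv subset_iff)
next
  case (mult x y)
  then show ?case using assms D_subset[OF assms(2)] subgroup.m_closed[OF D_subgroup[OF assms(2)]]
    by (auto simp: conjugate_mult subset_iff)
qed

lemma D_normal:
  assumes gen: "carrier H = generate H (f ` carrier G \<union> g ` carrier G)" and M: "M \<subseteq> carrier G"
  shows "D M \<lhd> H"
proof (rule normal_invI[OF D_subgroup[OF M]])
  have fg: "conjugate x (f c) \<in> D M" "conjugate x (g c) \<in> D M"
    if "x \<in> D M" "c \<in> carrier G" for x c
    using that conjugate_D_closed[OF _ M] conjugate_D[of x c] D_mono[OF M] by auto
  have conj: "\<forall>x\<in>D M. conjugate x k \<in> D M" if "k \<in> generate H (f ` carrier G \<union> g ` carrier G)" for k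
    using that
  proof (induction rule: generate.induct)
    case one
    then show ?case using D_subset[OF M] by auto
  next
    case (incl h)
    then show ?case using fg by auto
  next
    case (inv h)
    then obtain c where "c \<in> carrier G" "h = f c \<or> h = g c" by auto
    then show ?case using fg[of _ "inv\<^bsub>G\<^esub> c"] by auto
  next
    case (eng h k)
    then have hk: "h \<in> carrier H" "k \<in> carrier H" using gen by simp_all
    show ?case
    proof
      fix x assume x: "x \<in> D M"
      then have "conjugate (conjugate x h) k \<in> D M" using eng by blast
      then show "conjugate x (h \<otimes> k) \<in> D M"
        using x hk D_subset[OF M] conjugate_conjugate[of x h k] by auto
    qed
  qed
  fix k x assume "k \<in> carrier H" "x \<in> D M"
  then have "conjugate x (inv k) \<in> D M" using conj gen by (metis inv_closed)
  then show "k \<otimes> x \<otimes> inv k \<in> D M" using \<open>k \<in> carrier H\<close> by (simp add: conjugate_def)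
qed

text \<open>The four letters of \<open>d a b\<close> act one after the other; as each intermediate
  result lies in \<open>D(G)\<close>, every letter from \<open>g\<close> may be replaced by the one
  from \<open>f\<close>.\<close>

lemma conjugate_D_d:
  assumes x: "x \<in> D (carrier G)" and a: "a \<in> carrier G" and b: "b \<in> carrier G"
  shows "conjugate x (d a b) = conjugate x (f (commutator G a b))"
proof -
  let ?a = "inv\<^bsub>G\<^esub> a" and ?b = "inv\<^bsub>G\<^esub> b"
  have [simp]: "x \<in> carrier H" using x D_subset by auto
  have *: "y \<in> D (carrier G) \<Longrightarrow> c \<in> carrier G \<Longrightarrow> conjugate y (f c) \<in> D (carrier G)" for y c
    by (simp add: conjugate_D_closed)
  have "conjugate x (d a b) = conjugate (conjugate (conjugate (conjugate x (f ?a)) (g ?b)) (f a)) (g b)"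
    using a b by (simp add: d_def commutator_def conjugate_conjugate m_assoc)
  also have "\<dots> = conjugate (conjugate (conjugate (conjugate x (f ?a)) (f ?b)) (f a)) (f b)"
    using a b x by (simp add: conjugate_D * del: f.hom_inv g.hom_inv)
  also have "\<dots> = conjugate x (f (commutator G a b))"
    using a b by (simp add: commutator_def conjugate_conjugate m_assoc)
  finally show ?thesis .
qed

lemma conjugate_D_inv:
  assumes l: "l \<in> carrier G" and x: "x \<in> carrier H" and y: "y \<in> D (carrier G)"
    and xl: "\<And>y. y \<in> D (carrier G) \<Longrightarrow> conjugate y x = conjugate y (f l)"
  shows "conjugate y (inv x) = conjugate y (f (inv\<^bsub>G\<^esub> l))"
proof -
  \<comment> \<open>\<open>?z\<close> is carried to \<open>y\<close> by \<open>f l\<close> and,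
    lying in \<open>D(G)\<close>, also by \<open>x\<close>; so the inverse of \<open>x\<close> takes
    \<open>y\<close> back to \<open>?z\<close>.\<close>
  let ?z = "conjugate y (f (inv\<^bsub>G\<^esub> l))"
  have yH: "y \<in> carrier H" using y D_subset by auto
  have "?z \<in> D (carrier G)" using y l by (intro conjugate_D_closed) auto
  then have "conjugate (conjugate ?z x) (inv x) = conjugate (conjugate ?z (f l)) (inv x)"
    using xl by simp
  then show ?thesis using yH l x by (simp add: conjugate_conjugate m_assoc)
qed

text \<open>Generators act as commutators by \<open>conjugate_D_d\<close>, and the actions coming
  from \<open>L\<close> are closed under products and inverses. Used with \<open>L = M\<close> for
  normal \<open>M\<close>, and with \<open>L = Z\<close>, which acts trivially.\<close>

lemma D_acts_via:
  assumes M: "M \<subseteq> carrier G" and L: "subgroup L G"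
    and comm_L: "\<And>m a. m \<in> M \<Longrightarrow> a \<in> carrier G \<Longrightarrow> commutator G m a \<in> L"
    and x: "x \<in> D M"
  shows "\<exists>l\<in>L. \<forall>y\<in>D (carrier G). conjugate y x = conjugate y (f l)"
  using x M
proof (induction rule: D_induct)
  case (gen m a)
  then show ?case using comm_L M conjugate_D_d[of _ m a] by (intro bexI[of _ "commutator G m a"]) auto
next
  case one
  then show ?case using subgroup.one_closed[OF L] by force
next
  case (inv x)
  then obtain l where l: "l \<in> L" "\<forall>y\<in>D (carrier G). conjugate y x = conjugate y (f l)" by blast
  have lG: "l \<in> carrier G" and xH: "x \<in> carrier H"
    using l(1) subgroup.mem_carrier[OF L] inv D_subset[OF M] by auto
  have "conjugate y (inv x) = conjugate y (f (inv\<^bsub>G\<^esub> l))" if "y \<in> D (carrier G)" for y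
    using conjugate_D_inv[OF lG xH that] l(2) by blast
  then show ?case using subgroup.m_inv_closed[OF L l(1)] by blast
next
  case (mult x y)
  then obtain l k where l: "l \<in> L" "\<forall>z\<in>D (carrier G). conjugate z x = conjugate z (f l)"
    and k: "k \<in> L" "\<forall>z\<in>D (carrier G). conjugate z y = conjugate z (f k)" by blast
  have lG: "l \<in> carrier G" "k \<in> carrier G" and H: "x \<in> carrier H" "y \<in> carrier H"
    using l(1) k(1) subgroup.mem_carrier[OF L] mult D_subset[OF M] by auto
  have "conjugate z (x \<otimes> y) = conjugate z (f (l \<otimes>\<^bsub>G\<^esub> k))" if z: "z \<in> D (carrier G)" for z
  proof -
    have zX: "z \<in> carrier H" using z D_subset by auto
    have "conjugate z (x \<otimes> y) = conjugate (conjugate z (f l)) y"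
      using zX H l(2) z by (simp add: conjugate_conjugate[symmetric])
    also have "\<dots> = conjugate (conjugate z (f l)) (f k)"
      using k(2) conjugate_D_closed[OF z _ lG(1)] by simp
    finally show ?thesis using zX lG by (simp add: conjugate_conjugate)
  qed
  then show ?case using subgroup.m_closed[OF L l(1) k(1)] by blast
qed

section \<open>Powers in the first argument of \<open>d\<close>\<close>

text \<open>Conjugation by \<open>f m\<close> may be replaced by that by \<open>g m\<close>, which
  fixes \<open>f m\<close> and turns \<open>a\<close> into \<open>a [a, m]\<close>. The remaining
  conjugation by \<open>f [a, m]\<close> is that by \<open>d a m\<close>, the inverse of
  \<open>d m a\<close>, hence trivial on \<open>d m a\<close>.\<close>

lemma conjugate_d_self:
  assumes "m \<in> carrier G" "a \<in> carrier G"
  shows "conjugate (d m a) (f m) = d m (commutator G a m) \<otimes> d m a"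
proof -
  let ?u = "commutator G a m"
  have u: "?u \<in> carrier G" and au: "a \<otimes>\<^bsub>G\<^esub> ?u = G.conjugate a m"
    using assms by (simp_all add: G.conjugate_def commutator_def G.word_simps)
  have m: "inv (g m) \<otimes> f m \<otimes> g m = f m"
    using conjugate_eq_iff[of "f m" "g m" "f m"] commute assms by (simp add: conjugate_def)
  have "conjugate (d m a) (f m) = conjugate (d m a) (g m)"
    using assms by (simp add: conjugate_d)
  also have "\<dots> = commutator H (inv (g m) \<otimes> f m \<otimes> g m) (inv (g m) \<otimes> g a \<otimes> g m)"
    using assms by (simp add: conjugate_def commutator_def d_def word_simps)
  also have "\<dots> = d m (a \<otimes>\<^bsub>G\<^esub> ?u)"
    unfolding m au using assms by (simp add: d_def G.conjugate_def)
  also have "\<dots> = d m ?u \<otimes> conjugate (d m a) (f ?u)"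
    using assms u by (simp add: d_mult_right conjugate_d)
  also have "conjugate (d m a) (f ?u) = conjugate (d m a) (d a m)"
    using assms by (simp add: conjugate_D_d d_in_D)
  also have "\<dots> = d m a"
    using assms d_swap[of a m] by (simp add: conjugate_def m_assoc)
  finally show ?thesis .
qed

text \<open>Each further factor \<open>m\<close> conjugates the \<open>i\<close>-th power of
  \<open>d m a\<close> by \<open>f m\<close>, which adds \<open>c [^] i\<close>; the sum of
  \<open>0, ..., i - 1\<close> is \<open>i choose 2\<close>.\<close>

lemma d_pow:
  assumes m: "m \<in> carrier G" and a: "a \<in> carrier G" and c: "c \<in> carrier H"
    and t: "conjugate (d m a) (f m) = c \<otimes> d m a"
    and cm: "conjugate c (f m) = c" and ct: "c \<otimes> d m a = d m a \<otimes> c"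
  shows "d (m [^]\<^bsub>G\<^esub> (i::nat)) a = c [^] (i choose 2) \<otimes> d m a [^] i"
proof (induction i)
  case (Suc i)
  let ?t = "d m a"
  have [simp]: "?t \<in> carrier H" using m a by simp
  have "d (m [^]\<^bsub>G\<^esub> Suc i) a = conjugate (d (m [^]\<^bsub>G\<^esub> i) a) (f m) \<otimes> ?t"
    using m a by (simp add: d_mult_left)
  also have "\<dots> = c [^] (i choose 2) \<otimes> (c \<otimes> ?t) [^] i \<otimes> ?t"
    using m c by (simp add: Suc conjugate_mult conjugate_pow t cm)
  also have "(c \<otimes> ?t) [^] i = c [^] i \<otimes> ?t [^] i"
    by (rule pow_mult_distrib[OF ct c]) simp
  also have "c [^] (i choose 2) \<otimes> (c [^] i \<otimes> ?t [^] i) \<otimes> ?t = (c [^] (i choose 2) \<otimes> c [^] i) \<otimes> ?t [^] Suc i"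
    using c by (simp add: m_assoc)
  also have "c [^] (i choose 2) \<otimes> c [^] i = c [^] (Suc i choose 2)"
    using c by (simp add: nat_pow_mult numeral_2_eq_2 add.commute)
  finally show ?case .
qed (use m a in \<open>simp add: numeral_2_eq_2\<close>)

end

lemma (in group) normal_commutator:
  assumes "N \<lhd> G" "x \<in> N" "a \<in> carrier G"
  shows "commutator G x a \<in> N" "commutator G a x \<in> N"
proof -
  interpret N: normal N G by fact
  have x: "x \<in> carrier G" using assms(2) by simp
  have "inv x \<otimes> (inv a \<otimes> x \<otimes> a) \<in> N" "(inv a \<otimes> inv x \<otimes> a) \<otimes> x \<in> N"
    using assms(2,3) by (simp_all add: N.inv_op_closed1)
  then show "commutator G x a \<in> N" "commutator G a x \<in> N"
    using x assms(3) by (simp_all add: commutator_def m_assoc)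
qed

section \<open>Exponent bounds modulo a normal subgroup with trivial commutators\<close>

text \<open>\<open>H\<close> plays the role of a quotient by \<open>D Z\<close>, which is why
  \<open>d_Z\<close> may be assumed; in the application \<open>M\<close> and \<open>Z\<close> are
  consecutive terms of the derived series.\<close>

locale weakly_commuting_section = weakly_commuting_homs +
  fixes M Z :: "'a set" and n :: nat
  assumes M: "M \<lhd> G" and Z: "Z \<lhd> G"
    and M_commutator: "m \<in> M \<Longrightarrow> m' \<in> M \<Longrightarrow> commutator G m m' \<in> Z"
    and d_Z: "z \<in> Z \<Longrightarrow> a \<in> carrier G \<Longrightarrow> d z a = \<one>"
    and exponent: "a \<in> carrier G \<Longrightarrow> a [^]\<^bsub>G\<^esub> n = \<one>\<^bsub>G\<^esub>"
begin

lemma M_subset: "M \<subseteq> carrier G" and Z_subset: "Z \<subseteq> carrier G"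
  using M Z normal_imp_subgroup subgroup.subset by blast+

lemma d_Z': "z \<in> Z \<Longrightarrow> a \<in> carrier G \<Longrightarrow> d a z = \<one>"
  using d_swap[of a z] d_Z Z_subset by (simp add: subset_iff)

text \<open>As \<open>f z\<close> and all its conjugates under \<open>f\<close> commute with the image of \<open>g\<close>, each \<open>d a b\<close> fixes \<open>f z\<close>.\<close>

lemma Z_acts_trivially:
  assumes z: "z \<in> Z" and y: "y \<in> D (carrier G)"
  shows "conjugate y (f z) = y"
  using y subset_refl[of "carrier G"]
proof (induction rule: D_induct)
  case (gen a b)
  \<comment> \<open>On its way leftwards through the letters of \<open>d a b\<close>,
    \<open>f z\<close> becomes \<open>f w\<close> at \<open>f a\<close> and returns to
    \<open>f z\<close> at the inverse of \<open>f a\<close>; it passes the letters from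
    \<open>g\<close> unchanged.\<close>
  define w where "w = a \<otimes>\<^bsub>G\<^esub> z \<otimes>\<^bsub>G\<^esub> inv\<^bsub>G\<^esub> a"
  have zG: "z \<in> carrier G" and w: "w \<in> Z" "w \<in> carrier G"
    using z Z_subset normal.inv_op_closed2[OF Z gen(1) z] by (auto simp: w_def)
  note [simp] = f.hom_closed[OF gen(1)] g.hom_closed[OF gen(2)] f.hom_closed[OF zG] f.hom_closed[OF w(2)]
  have zb: "f z \<otimes> g b = g b \<otimes> f z" and wb: "f w \<otimes> g b = g b \<otimes> f w"
    using d_Z[OF z gen(2)] d_Z[OF w(1) gen(2)] d_one_iff gen zG w by auto
  have "conjugate (f w) (g b) = f w" using wb by (simp add: conjugate_eq_iff)
  then have "conjugate (f w) (inv (g b)) = f w"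
    using conjugate_conjugate[of "f w" "g b" "inv (g b)"] by simp
  then have wb': "inv (g b) \<otimes> f w = f w \<otimes> inv (g b)" by (simp add: conjugate_eq_iff)
  have aw: "f a \<otimes> f z = f w \<otimes> f a" using gen zG by (simp add: w_def word_simps)
  have aw': "inv (f a) \<otimes> f w = f z \<otimes> inv (f a)" using gen zG by (simp add: w_def word_simps)
  have "d a b \<otimes> f z = inv (f a) \<otimes> inv (g b) \<otimes> (f a \<otimes> f z) \<otimes> g b"
    by (simp add: d_def commutator_def m_assoc zb)
  also have "\<dots> = inv (f a) \<otimes> (inv (g b) \<otimes> f w) \<otimes> f a \<otimes> g b"
    unfolding aw by (simp add: m_assoc)
  also have "\<dots> = (inv (f a) \<otimes> f w) \<otimes> inv (g b) \<otimes> f a \<otimes> g b"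
    unfolding wb' by (simp add: m_assoc)
  also have "\<dots> = f z \<otimes> d a b"
    unfolding aw' by (simp add: d_def commutator_def m_assoc)
  finally show ?case using gen zG by (simp add: conjugate_eq_iff)
next
  case (inv y)
  then show ?case using z Z_subset D_subset[of "carrier G"] by (auto simp: conjugate_inv subset_iff)
next
  case (mult x y)
  then show ?case using z Z_subset D_subset[of "carrier G"] by (auto simp: conjugate_mult subset_iff)
qed (use z Z_subset in auto)

lemma conjugate_d_Z:
  assumes "a \<in> carrier G" "b \<in> carrier G" "commutator G a b \<in> Z" "y \<in> D (carrier G)"
  shows "conjugate y (d a b) = y"
  using assms Z_acts_trivially conjugate_D_d by simp

section \<open>Central powers and commutators, and the resulting bounds\<close>

text \<open>\<open>x\<close> acts on \<open>D(G)\<close> as some \<open>f l\<close>, so its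
  \<open>n\<close>-th power acts as \<open>f\<close> of the \<open>n\<close>-th power of
  \<open>l\<close>, which is trivial.\<close>

lemma D_pow_central:
  assumes x: "x \<in> D M" and y: "y \<in> D (carrier G)"
  shows "conjugate y (x [^] n) = y"
proof -
  obtain l where l: "l \<in> M" "\<forall>y\<in>D (carrier G). conjugate y x = conjugate y (f l)"
    using D_acts_via[OF M_subset normal_imp_subgroup[OF M] _ x] G.normal_commutator(1)[OF M] by blast
  have lG: "l \<in> carrier G" and xH: "x \<in> carrier H" and yH: "y \<in> carrier H"
    using l(1) M_subset x y D_subset M_subset by auto
  have "conjugate y (x [^] i) = conjugate y (f l [^] i)" for i :: nat
  proof (induction i)
    case (Suc i)
    have "conjugate y (f l [^] i) \<in> D (carrier G)"
      using conjugate_D_closed[OF y subset_refl, of "l [^]\<^bsub>G\<^esub> i"] lG by (simp add: f.hom_nat_pow)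
    then have "conjugate (conjugate y (f l [^] i)) x = conjugate (conjugate y (f l [^] i)) (f l)"
      using l(2) by blast
    then show ?case using Suc lG xH yH by (simp add: conjugate_conjugate[symmetric])
  qed simp
  then have "conjugate y (x [^] n) = conjugate y (f (l [^]\<^bsub>G\<^esub> n))"
    using lG by (simp add: f.hom_nat_pow)
  then show ?thesis using exponent[OF lG] yH by simp
qed

text \<open>\<open>x\<close> and \<open>y\<close> act as \<open>f l\<close> and \<open>f k\<close>
  with \<open>l\<close>, \<open>k\<close> in \<open>M\<close>, so their commutator acts as
  \<open>f\<close> of an element of \<open>Z\<close>.\<close>

lemma D_commutator_central:
  assumes x: "x \<in> D M" and y: "y \<in> D M" and w: "w \<in> D (carrier G)"
  shows "conjugate w (commutator H x y) = w"
proof -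
  have acts: "\<exists>l\<in>M. \<forall>y\<in>D (carrier G). conjugate y x = conjugate y (f l)" if "x \<in> D M" for x
    using D_acts_via[OF M_subset normal_imp_subgroup[OF M] _ that] G.normal_commutator(1)[OF M] by blast
  obtain l l' k k' where l: "l \<in> M" "\<And>y. y \<in> D (carrier G) \<Longrightarrow> conjugate y x = conjugate y (f l)"
    and k: "k \<in> M" "\<And>w. w \<in> D (carrier G) \<Longrightarrow> conjugate w y = conjugate w (f k)"
    using acts[OF x] acts[OF y] by blast
  have [simp]: "l \<in> carrier G" "k \<in> carrier G" "x \<in> carrier H" "y \<in> carrier H" "w \<in> carrier H"
    using l(1) k(1) x y w M_subset D_subset[of M] D_subset[of "carrier G"] by auto
  have step: "conjugate w (f c) \<in> D (carrier G)" if "w \<in> D (carrier G)" "c \<in> carrier G" for w c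
    using conjugate_D_closed[OF that(1) _ that(2)] by simp
  have "conjugate w (commutator H x y) = conjugate (conjugate (conjugate (conjugate w (inv x)) (inv y)) x) y"
    by (simp add: commutator_def conjugate_conjugate)
  also have "\<dots> = conjugate (conjugate (conjugate (conjugate w (f (inv\<^bsub>G\<^esub> l))) (f (inv\<^bsub>G\<^esub> k))) (f l)) (f k)"
    using w by (simp add: conjugate_D_inv[OF _ _ _ l(2)] conjugate_D_inv[OF _ _ _ k(2)] l(2) k(2) step del: f.hom_inv)
  also have "\<dots> = conjugate w (f (commutator G l k))"
    by (simp add: commutator_def conjugate_conjugate)
  finally show ?thesis using Z_acts_trivially[OF M_commutator[OF l(1) k(1)] w] by simp
qed

text \<open>Both arguments of \<open>c\<close> lie in \<open>M\<close>, so their commutators lie in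
  \<open>Z\<close>. Therefore \<open>c\<close> centralises \<open>D(G)\<close> and is fixed by
  \<open>f m\<close>, as \<open>d_pow\<close> requires.\<close>

lemma d_exponent:
  assumes m: "m \<in> M" and a: "a \<in> carrier G" and e: "n dvd e" "n dvd (e choose 2)"
  shows "d m a [^] e = \<one>"
proof -
  let ?u = "commutator G a m"
  define c where "c = d m ?u"
  have mG: "m \<in> carrier G" using m M_subset by auto
  have u: "?u \<in> M" "?u \<in> carrier G" using G.normal_commutator(2)[OF M m a] M_subset by auto
  have cH: "c \<in> carrier H" using mG u by (simp add: c_def)
  have "conjugate c (f m) = d m (commutator G ?u m) \<otimes> c"
    unfolding c_def using conjugate_d_self mG u by simp
  then have cm: "conjugate c (f m) = c"
    using d_Z'[OF M_commutator[OF u(1) m] mG] cH by simp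
  have c_central: "c \<otimes> y = y \<otimes> c" if "y \<in> D (carrier G)" for y
    using conjugate_d_Z[OF mG u(2) M_commutator[OF m u(1)] that] that D_subset[of "carrier G"] cH
    by (metis c_def conjugate_eq_iff subset_refl subsetD)
  \<comment> \<open>\<open>d_pow\<close> with \<open>?u\<close> in place of \<open>a\<close>: the
    correction term is now \<open>\<one>\<close>, and the left side is trivial since
    \<open>m\<close> has trivial \<open>n\<close>-th power.\<close>
  have "d (m [^]\<^bsub>G\<^esub> n) ?u = \<one> [^] (n choose 2) \<otimes> c [^] n"
    unfolding c_def using mG u cm cH by (intro d_pow) (simp_all add: c_def)
  then have cn: "c [^] n = \<one>" using exponent[OF mG] u cH by simp
  have "d (m [^]\<^bsub>G\<^esub> e) a = c [^] (e choose 2) \<otimes> d m a [^] e"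
    using mG a cH cm c_central[OF d_in_D[OF mG a]]
    by (intro d_pow) (simp_all add: c_def conjugate_d_self)
  moreover have "m [^]\<^bsub>G\<^esub> e = \<one>\<^bsub>G\<^esub>" using exponent[OF mG] e(1) mG by (metis G.pow_dvd_one)
  ultimately show ?thesis using pow_dvd_one[OF cH cn e(2)] mG a by simp
qed

text \<open>For a product the collection formula adds \<open>?z\<close> to the power
  \<open>e choose 2\<close>. Its first part gives \<open>?z [^] n = \<one>\<close>, because
  \<open>y [^] n\<close> commutes with \<open>x\<close>.\<close>

theorem D_exponent:
  assumes x: "x \<in> D M" and e: "n dvd e" "n dvd (e choose 2)"
  shows "x [^] e = \<one>"
  using x M_subset
proof (induction rule: D_induct)
  case (gen m a)
  then show ?case using d_exponent e by simp
next
  case (inv x)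
  then have "x \<in> carrier H" using D_subset[OF M_subset] by blast
  then show ?case using inv by (simp add: nat_pow_inv)
next
  case (mult x y)
  let ?z = "commutator H y x"
  have D: "x \<in> D (carrier G)" "y \<in> D (carrier G)" using mult D_mono[OF M_subset] by auto
  have H: "x \<in> carrier H" "y \<in> carrier H" "?z \<in> carrier H" using D D_subset[of "carrier G"] by auto
  have yx: "y \<otimes> x = x \<otimes> y \<otimes> ?z" using commutator_commutes H by simp
  have z: "x \<otimes> ?z = ?z \<otimes> x" "y \<otimes> ?z = ?z \<otimes> y"
    by (rule iffD1[OF conjugate_eq_iff] D_commutator_central[OF mult(2,1)] H D)+
  note pow = pow_mult_central_commutator[OF H yx z]
  have "conjugate x (y [^] n) = x" using D_pow_central mult(2) D(1) by simp
  then have "x \<otimes> y [^] n = y [^] n \<otimes> x" using H by (simp add: conjugate_eq_iff)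
  then have "x \<otimes> y [^] n \<otimes> ?z [^] n = x \<otimes> y [^] n \<otimes> \<one>"
    using pow(1)[of n] H(1,2) by (metis m_closed nat_pow_closed r_one)
  then have "?z [^] n = \<one>" using H by (metis l_cancel m_closed nat_pow_closed one_closed)
  then have "?z [^] (e choose 2) = \<one>" by (rule pow_dvd_one[OF H(3) _ e(2)])
  then show ?case unfolding pow(2)[of e] mult(3,4) by simp
qed simp

text \<open>With \<open>[M, G]\<close> inside \<open>Z\<close> the correction term
  \<open>d m [a, m]\<close> is trivial and \<open>D M\<close> is abelian, so no binomial coefficient
  has to be divisible by \<open>n\<close>. For \<open>M = G\<close> this saves a factor
  \<open>2\<close>.\<close>

theorem D_exponent_central:
  assumes x: "x \<in> D M" and MZ: "\<And>m a. m \<in> M \<Longrightarrow> a \<in> carrier G \<Longrightarrow> commutator G m a \<in> Z"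
  shows "x [^] n = \<one>"
  using x M_subset
proof (induction rule: D_induct)
  case (gen m a)
  then have m: "m \<in> carrier G" using M_subset by auto
  have "commutator G a m \<in> Z"
    using MZ[OF gen] G.inv_commutator[OF m gen(2)] subgroup.m_inv_closed[OF normal_imp_subgroup[OF Z]] by metis
  then have "d m (commutator G a m) = \<one>" using d_Z' m by simp
  then have "conjugate (d m a) (f m) = \<one> \<otimes> d m a" using conjugate_d_self m gen by simp
  then have "d (m [^]\<^bsub>G\<^esub> n) a = \<one> [^] (n choose 2) \<otimes> d m a [^] n"
    using m gen by (intro d_pow) simp_all
  then show ?case using exponent[OF m] m gen by simp
next
  case (inv x)
  then have "x \<in> carrier H" using D_subset[OF M_subset] by blast
  then show ?case using inv by (simp add: nat_pow_inv)
next
  case (mult x y)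
  have D: "x \<in> D (carrier G)" "y \<in> D (carrier G)" using mult D_mono[OF M_subset] by auto
  have H: "x \<in> carrier H" "y \<in> carrier H" using D D_subset[of "carrier G"] by auto
  obtain l where "l \<in> Z" "\<forall>w\<in>D (carrier G). conjugate w y = conjugate w (f l)"
    using D_acts_via[OF M_subset normal_imp_subgroup[OF Z] MZ mult(2)] by blast
  then have "conjugate x y = x" using Z_acts_trivially D by simp
  then have "x \<otimes> y = y \<otimes> x" using H by (simp add: conjugate_eq_iff)
  then show ?case using mult H by (simp add: pow_mult_distrib)
qed simp

end


section \<open>Descent along the derived series\<close>

context weakly_commuting_homs
begin

section \<open>Passing to quotients by \<open>D Z\<close>\<close>

lemma compose:
  assumes "group_hom H K q"
  shows "weakly_commuting_homs G K (q \<circ> f) (q \<circ> g)"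
proof -
  interpret q: group_hom H K q by fact
  show ?thesis
  proof
    show "q \<circ> f \<in> hom G K" "q \<circ> g \<in> hom G K"
      using Group.hom_compose[OF f_hom q.homh] Group.hom_compose[OF g_hom q.homh] by auto
    show "(q \<circ> f) a \<otimes>\<^bsub>K\<^esub> (q \<circ> g) a = (q \<circ> g) a \<otimes>\<^bsub>K\<^esub> (q \<circ> f) a" if "a \<in> carrier G" for a
      using that commute[OF that] by (simp flip: q.hom_mult)
  qed
qed

lemma d_compose:
  assumes "group_hom H K q" "a \<in> carrier G" "b \<in> carrier G"
  shows "weakly_commuting_homs.d K (q \<circ> f) (q \<circ> g) a b = q (d a b)"
  using assms weakly_commuting_homs.d_def[OF compose[OF assms(1)]]
  by (simp add: d_def group_hom.hom_commutator)

lemma D_compose: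
  assumes "group_hom H K q" "M \<subseteq> carrier G"
  shows "weakly_commuting_homs.D G K (q \<circ> f) (q \<circ> g) M = q ` D M"
proof -
  let ?d = "weakly_commuting_homs.d K (q \<circ> f) (q \<circ> g)"
  have eq: "?d m a = q (d m a)" if "m \<in> M" "a \<in> carrier G" for m a
    using d_compose[OF assms(1)] assms(2) that by blast
  have "{?d m a | m a. m \<in> M \<and> a \<in> carrier G} = q ` {d m a | m a. m \<in> M \<and> a \<in> carrier G}" (is "?L = ?R")
  proof (intro equalityI subsetI)
    fix y assume "y \<in> ?L"
    then obtain m a where "y = ?d m a" "m \<in> M" "a \<in> carrier G" by blast
    then show "y \<in> ?R" using eq by auto
  next
    fix y assume "y \<in> ?R"
    then obtain m a where "y = q (d m a)" "m \<in> M" "a \<in> carrier G" by blast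
    then show "y \<in> ?L" using eq[of m a] by (intro CollectI exI[of _ m] exI[of _ a]) simp
  qed
  then show ?thesis
    using weakly_commuting_homs.D_def[OF compose[OF assms(1)]] assms
    by (simp add: D_def group_hom.generate_img D_generators)
qed

lemma D_quotient:
  assumes gen: "carrier H = generate H (f ` carrier G \<union> g ` carrier G)" and Z: "Z \<subseteq> carrier G"
  obtains K :: "'x set monoid" and q where "group_hom H K q"
    "\<And>x. x \<in> carrier H \<Longrightarrow> q x = \<one>\<^bsub>K\<^esub> \<longleftrightarrow> x \<in> D Z"
proof
  interpret N: normal "D Z" H using D_normal[OF gen Z] .
  interpret K: group "H Mod D Z" by (rule N.factorgroup_is_group)
  show "group_hom H (H Mod D Z) (\<lambda>x. D Z #> x)"
    by unfold_locales (rule N.r_coset_hom_Mod)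
  show "D Z #> x = \<one>\<^bsub>H Mod D Z\<^esub> \<longleftrightarrow> x \<in> D Z" if "x \<in> carrier H" for x
    using that coset_join1[OF _ that] coset_join2[OF that] N.subgroup_axioms by auto
qed

lemma D_section:
  assumes "group_hom H K q" "\<And>x. x \<in> D Z \<Longrightarrow> q x = \<one>\<^bsub>K\<^esub>"
    and "M \<lhd> G" "Z \<lhd> G"
    and "\<And>m m'. m \<in> M \<Longrightarrow> m' \<in> M \<Longrightarrow> commutator G m m' \<in> Z"
    and "\<And>a. a \<in> carrier G \<Longrightarrow> a [^]\<^bsub>G\<^esub> n = \<one>\<^bsub>G\<^esub>"
  shows "weakly_commuting_section G K (q \<circ> f) (q \<circ> g) M Z n"
proof -
  interpret S: weakly_commuting_homs G K "q \<circ> f" "q \<circ> g" by (rule compose) fact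
  show ?thesis
  proof (intro weakly_commuting_section.intro weakly_commuting_section_axioms.intro S.weakly_commuting_homs_axioms)
    fix z a assume za: "z \<in> Z" "a \<in> carrier G"
    then have "z \<in> carrier G" using \<open>Z \<lhd> G\<close> normal_imp_subgroup subgroup.mem_carrier by metis
    then show "S.d z a = \<one>\<^bsub>K\<^esub>" using d_compose[OF assms(1)] za assms(2) d_in_D by simp
  qed (use assms in simp_all)
qed

text \<open>Both bounds hold in the quotient by \<open>D Z\<close>, and \<open>iff\<close>
  translates them back to \<open>H\<close>.\<close>

lemma D_pow_section:
  assumes gen: "carrier H = generate H (f ` carrier G \<union> g ` carrier G)"
    and M: "M \<lhd> G" and Z: "Z \<lhd> G"
    and MM: "\<And>m m'. m \<in> M \<Longrightarrow> m' \<in> M \<Longrightarrow> commutator G m m' \<in> Z"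
    and n: "\<And>a. a \<in> carrier G \<Longrightarrow> a [^]\<^bsub>G\<^esub> (n::nat) = \<one>\<^bsub>G\<^esub>"
    and x: "x \<in> D M"
  shows "n dvd e \<Longrightarrow> n dvd (e choose 2) \<Longrightarrow> x [^] e \<in> D Z"
    and "(\<And>m a. m \<in> M \<Longrightarrow> a \<in> carrier G \<Longrightarrow> commutator G m a \<in> Z) \<Longrightarrow> x [^] n \<in> D Z"
proof -
  have MG: "M \<subseteq> carrier G" and ZG: "Z \<subseteq> carrier G"
    using M Z normal_imp_subgroup subgroup.subset by blast+
  have xH: "x \<in> carrier H" using x D_subset[OF MG] by auto
  obtain K :: "'x set monoid" and q where q: "group_hom H K q"
    "\<And>x. x \<in> carrier H \<Longrightarrow> q x = \<one>\<^bsub>K\<^esub> \<longleftrightarrow> x \<in> D Z"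
    using D_quotient[OF gen ZG] by blast
  interpret q: group_hom H K q by fact
  interpret S: weakly_commuting_section G K "q \<circ> f" "q \<circ> g" M Z n
    by (rule D_section[OF q(1) _ M Z MM n]) (use q(2) D_subset[OF ZG] in auto)
  have qx: "q x \<in> S.D M" using x D_compose[OF q(1) MG] by simp
  have iff: "x [^] k \<in> D Z \<longleftrightarrow> q x [^]\<^bsub>K\<^esub> k = \<one>\<^bsub>K\<^esub>" for k :: nat
    using q(2)[of "x [^] k"] xH by (simp add: q.hom_nat_pow)
  show "n dvd e \<Longrightarrow> n dvd (e choose 2) \<Longrightarrow> x [^] e \<in> D Z"
    using S.D_exponent[OF qx] iff by blast
  show "(\<And>m a. m \<in> M \<Longrightarrow> a \<in> carrier G \<Longrightarrow> commutator G m a \<in> Z) \<Longrightarrow> x [^] n \<in> D Z"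
    using S.D_exponent_central[OF qx] iff by blast
qed

section \<open>Powers in \<open>H\<close> and along the derived series\<close>

text \<open>Modulo \<open>D(G)\<close> the two images commute elementwise, so every element is the
  image of some \<open>f a\<close> times that of some \<open>g b\<close>, and its
  \<open>n\<close>-th power is computed factor by factor.\<close>

lemma pow_in_D:
  assumes gen: "carrier H = generate H (f ` carrier G \<union> g ` carrier G)"
    and n: "\<And>a. a \<in> carrier G \<Longrightarrow> a [^]\<^bsub>G\<^esub> (n::nat) = \<one>\<^bsub>G\<^esub>"
    and x: "x \<in> carrier H"
  shows "x [^] n \<in> D (carrier G)"
proof -
  obtain K :: "'x set monoid" and q where q: "group_hom H K q"
    "\<And>x. x \<in> carrier H \<Longrightarrow> q x = \<one>\<^bsub>K\<^esub> \<longleftrightarrow> x \<in> D (carrier G)"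
    using D_quotient[OF gen subset_refl] by blast
  interpret q: group_hom H K q by fact
  have comm: "q (f a) \<otimes>\<^bsub>K\<^esub> q (g b) = q (g b) \<otimes>\<^bsub>K\<^esub> q (f a)" if "a \<in> carrier G" "b \<in> carrier G" for a b
  proof -
    have "commutator K (q (f a)) (q (g b)) = \<one>\<^bsub>K\<^esub>"
      using q(2)[of "d a b"] d_in_D that by (simp add: d_def q.hom_commutator)
    then show ?thesis using that by (simp add: q.H.commutator_one_iff)
  qed
  have "\<exists>a\<in>carrier G. \<exists>b\<in>carrier G. q x = q (f a) \<otimes>\<^bsub>K\<^esub> q (g b)"
    if "x \<in> generate H (f ` carrier G \<union> g ` carrier G)" for x
    using that
  proof (induction rule: generate.induct)
    case one
    show ?case by (intro bexI[of _ "\<one>\<^bsub>G\<^esub>"]) auto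
  next
    case (incl h)
    then obtain a where "a \<in> carrier G" "h = f a \<or> h = g a" by auto
    then show ?case
      by (metis G.one_closed f.hom_closed f.hom_one g.hom_closed g.hom_one q.H.l_one q.H.r_one q.hom_closed q.hom_one)
  next
    case (inv h)
    then obtain a where "a \<in> carrier G" "inv h = f (inv\<^bsub>G\<^esub> a) \<or> inv h = g (inv\<^bsub>G\<^esub> a)" by auto
    then show ?case
      by (metis G.inv_closed G.one_closed f.hom_closed f.hom_one g.hom_closed g.hom_one q.H.l_one q.H.r_one q.hom_closed q.hom_one)
  next
    case (eng h k)
    then obtain a b a' b' where ab: "a \<in> carrier G" "b \<in> carrier G" "a' \<in> carrier G" "b' \<in> carrier G"
      and h: "q h = q (f a) \<otimes>\<^bsub>K\<^esub> q (g b)" and k: "q k = q (f a') \<otimes>\<^bsub>K\<^esub> q (g b')" by blast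
    have "h \<in> carrier H" "k \<in> carrier H" using eng(1,2) gen by simp_all
    then have "q (h \<otimes> k) = q (f a) \<otimes>\<^bsub>K\<^esub> (q (g b) \<otimes>\<^bsub>K\<^esub> q (f a')) \<otimes>\<^bsub>K\<^esub> q (g b')"
      using ab by (simp add: h k q.H.m_assoc)
    also have "\<dots> = q (f (a \<otimes>\<^bsub>G\<^esub> a')) \<otimes>\<^bsub>K\<^esub> q (g (b \<otimes>\<^bsub>G\<^esub> b'))"
      unfolding comm[OF ab(3,2), symmetric] using ab by (simp add: q.H.m_assoc)
    finally show ?case using ab by blast
  qed
  then obtain a b where ab: "a \<in> carrier G" "b \<in> carrier G" and qx: "q x = q (f a) \<otimes>\<^bsub>K\<^esub> q (g b)"
    using x gen by blast
  have "q (x [^] n) = q (f (a [^]\<^bsub>G\<^esub> n)) \<otimes>\<^bsub>K\<^esub> q (g (b [^]\<^bsub>G\<^esub> n))"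
    using ab x q.H.pow_mult_distrib[OF comm[OF ab]]
    by (simp add: q.hom_nat_pow f.hom_nat_pow g.hom_nat_pow qx)
  then show ?thesis using n ab x q(2)[of "x [^] n"] by simp
qed

theorem D_pow_derived_series:
  assumes gen: "carrier H = generate H (f ` carrier G \<union> g ` carrier G)"
    and n: "\<And>a. a \<in> carrier G \<Longrightarrow> a [^]\<^bsub>G\<^esub> (n::nat) = \<one>\<^bsub>G\<^esub>"
    and m: "n dvd (m * n choose 2)"
    and l: "(derived G ^^ l) (carrier G) = {\<one>\<^bsub>G\<^esub>}" and x: "x \<in> D (carrier G)"
  shows "x [^] (m ^ (l - 1) * n ^ l) = \<one>"
proof -
  let ?S = "\<lambda>i. (derived G ^^ i) (carrier G)"
  have S: "?S i \<lhd> G" for i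
    by (induction i) (auto simp: G.normal_self G.derived_is_normal)
  have comm_S: "commutator G a b \<in> ?S (Suc i)" if ab: "a \<in> ?S i" "b \<in> ?S i" for a b i
  proof -
    have "inv\<^bsub>G\<^esub> a \<in> ?S i" "inv\<^bsub>G\<^esub> b \<in> ?S i"
      using ab subgroup.m_inv_closed[OF normal_imp_subgroup[OF S]] by auto
    moreover have "a \<in> carrier G" "b \<in> carrier G"
      using ab subgroup.mem_carrier[OF normal_imp_subgroup[OF S]] by auto
    \<comment> \<open>\<open>derived_set\<close> consists of products \<open>x y x^-1 y^-1\<close>,
      so the witnesses are the inverses of \<open>a\<close> and \<open>b\<close>.\<close>
    ultimately have "commutator G a b \<in> derived_set G (?S i)"
      unfolding commutator_def by (intro UN_I[of "inv\<^bsub>G\<^esub> a"] UN_I[of "inv\<^bsub>G\<^esub> b"]) auto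
    then show ?thesis by (simp add: derived_def generate.incl)
  qed
  have xH: "x \<in> carrier H" using x D_subset by auto
  \<comment> \<open>The step from \<open>G\<close> to its derived subgroup costs only
    \<open>n\<close>, each later one \<open>m * n\<close>; hence \<open>m\<close> occurs once less
    often than \<open>n\<close>.\<close>
  have "x [^] (m ^ i * n ^ Suc i) \<in> D (?S (Suc i))" for i
  proof (induction i)
    case 0
    have "x [^] n \<in> D (?S (Suc 0))"
      using x by (intro D_pow_section(2)[OF gen S[of 0] S[of "Suc 0"] comm_S n] comm_S[of _ 0])
        (simp_all del: funpow.simps(2))
    then show ?case by (simp del: funpow.simps)
  next
    case (Suc i)
    have "(x [^] (m ^ i * n ^ Suc i)) [^] (m * n) \<in> D (?S (Suc (Suc i)))"
      using Suc m by (intro D_pow_section(1)[OF gen S[of "Suc i"] S[of "Suc (Suc i)"] comm_S n])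
        (simp_all del: funpow.simps)
    then show ?case using xH by (simp add: nat_pow_pow ac_simps del: funpow.simps)
  qed
  note step = this
  show ?thesis
  proof (cases l)
    \<comment> \<open>Here \<open>G\<close> is trivial and the truncated \<open>l - 1\<close> is
      \<open>0\<close>, so that the exponent of \<open>x\<close> is \<open>1\<close>.\<close>
    case 0
    then have "x \<in> {\<one>}" using x l D_one by simp
    then show ?thesis by simp
  next
    case (Suc i)
    then have "x [^] (m ^ i * n ^ Suc i) \<in> {\<one>}" using step[of i] l D_one by metis
    then show ?thesis using Suc by simp
  qed
qed

end

section \<open>The weak commutativity group\<close>

text \<open>A word is the product of its letters, and a single letter represents a value of
  \<open>wc_base\<close> or \<open>wc_copy\<close>.\<close>

lemma weak_comm_generated:
  assumes "group G"
  shows "carrier (weak_comm G) =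
    generate (weak_comm G) (wc_base G ` carrier G \<union> wc_copy G ` carrier G)" (is "_ = ?gen")
proof
  interpret F: group "free_product G G" by (rule group_free_product[OF assms assms])
  interpret X: group "weak_comm G" by (rule group_weak_comm[OF assms])
  interpret N: normal "wc_kernel G" "free_product G G" by (rule wc_kernel_normal[OF assms])
  let ?q = "\<lambda>A. wc_kernel G #>\<^bsub>free_product G G\<^esub> A"
  interpret q: group_hom "free_product G G" "weak_comm G" ?q
    by unfold_locales (simp add: weak_comm_def N.r_coset_hom_Mod)
  show "?gen \<subseteq> carrier (weak_comm G)"
    using hom_in_carrier[OF wc_base_hom[OF assms]] hom_in_carrier[OF wc_copy_hom[OF assms]]
    by (intro X.generate_incl) auto
  have word: "?q (fp_cong G G `` {w}) \<in> ?gen" if "w \<in> fp_words G G" for w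
    using that
  proof (induction w)
    case Nil
    show ?case using generate.one[of "weak_comm G"] q.hom_one by (simp add: fp_one)
  next
    case (Cons s w)
    then have w: "w \<in> fp_words G G" and s: "[s] \<in> fp_words G G" by (cases s; simp)+
    have "?q (fp_cong G G `` {s # w}) = ?q (fp_cong G G `` {[s]}) \<otimes>\<^bsub>weak_comm G\<^esub> ?q (fp_cong G G `` {w})"
      using fp_mult_class[OF assms assms s w] fp_class_carrier[OF s] fp_class_carrier[OF w]
      by (simp flip: q.hom_mult)
    moreover have "?q (fp_cong G G `` {[s]}) \<in> ?gen"
      using s by (cases s) (auto intro!: generate.incl simp: wc_base_def wc_copy_def fp_left_def fp_right_def)
    ultimately show ?case using Cons.IH[OF w] generate.eng by metis
  qed
  show "carrier (weak_comm G) \<subseteq> ?gen"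
  proof
    fix x assume "x \<in> carrier (weak_comm G)"
    then obtain A where "A \<in> carrier (free_product G G)" "x = ?q A"
      by (auto simp: weak_comm_def carrier_FactGroup)
    then show "x \<in> ?gen" using word by (metis fp_carrierE)
  qed
qed

lemma weak_comm_homs:
  assumes "group G"
  shows "weakly_commuting_homs G (weak_comm G) (wc_base G) (wc_copy G)"
proof -
  interpret G: group G by fact
  interpret F: group "free_product G G" by (rule group_free_product[OF assms assms])
  interpret X: group "weak_comm G" by (rule group_weak_comm[OF assms])
  interpret N: normal "wc_kernel G" "free_product G G" by (rule wc_kernel_normal[OF assms])
  let ?q = "\<lambda>A. wc_kernel G #>\<^bsub>free_product G G\<^esub> A"
  interpret q: group_hom "free_product G G" "weak_comm G" ?q
    by unfold_locales (simp add: weak_comm_def N.r_coset_hom_Mod)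
  show ?thesis
  proof
    fix a assume a: "a \<in> carrier G"
    let ?c = "commutator (free_product G G) (fp_left G G a) (fp_right G G a)"
    have lr: "fp_left G G a \<in> carrier (free_product G G)" "fp_right G G a \<in> carrier (free_product G G)"
      using a hom_in_carrier[OF fp_left_hom[OF assms assms]] hom_in_carrier[OF fp_right_hom[OF assms assms]]
      by auto
    \<comment> \<open>The normal closure is generated by conjugates, so the relator is written as
      its conjugate by the identity.\<close>
    then have "?c = \<one>\<^bsub>free_product G G\<^esub> \<otimes>\<^bsub>free_product G G\<^esub> ?c \<otimes>\<^bsub>free_product G G\<^esub>
        inv\<^bsub>free_product G G\<^esub> \<one>\<^bsub>free_product G G\<^esub>" by simp
    then have "?c \<in> wc_kernel G"
      unfolding wc_kernel_def normal_closure_def wc_relators_def using a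
      by (intro generate.incl CollectI) blast
    then have "?q ?c = \<one>\<^bsub>weak_comm G\<^esub>"
      using F.coset_join2[OF _ N.subgroup_axioms] lr by (simp add: weak_comm_def)
    then show "wc_base G a \<otimes>\<^bsub>weak_comm G\<^esub> wc_copy G a = wc_copy G a \<otimes>\<^bsub>weak_comm G\<^esub> wc_base G a"
      using lr by (simp add: q.hom_commutator X.commutator_one_iff wc_base_def wc_copy_def)
  qed (rule wc_base_hom[OF assms] wc_copy_hom[OF assms])+
qed

theorem theorem1p1:
  fixes G :: "('a, 'm) monoid_scheme" and d :: nat
  assumes "group G" and "finite (carrier G)" and "solvable G" and "derived_length G = d"
  shows "(odd (order G) \<longrightarrow>
            group_exponent (D_group G) dvd group_exponent G ^ d \<and>
            group_exponent (weak_comm G) dvd group_exponent G ^ (d + 1)) \<and>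
         (even (order G) \<longrightarrow>
            group_exponent (D_group G) dvd 2 ^ (d - 1) * group_exponent G ^ d \<and>
            group_exponent (weak_comm G) dvd 2 ^ (d - 1) * group_exponent G ^ (d + 1))"
proof -
  let ?X = "weak_comm G" and ?n = "group_exponent G"
  interpret weakly_commuting_homs G ?X "wc_base G" "wc_copy G" by (rule weak_comm_homs) fact
  note gen = weak_comm_generated[OF assms(1)]
  have n: "?n > 0" "\<And>a. a \<in> carrier G \<Longrightarrow> a [^]\<^bsub>G\<^esub> ?n = \<one>\<^bsub>G\<^esub>"
    using G.group_exponent_finite[OF assms(2)] by auto
  have "\<exists>i. (derived G ^^ i) (carrier G) = {\<one>\<^bsub>G\<^esub>}"
    using G.solvable_iff_trivial_derived_seq assms(3) by blast
  then have "(derived G ^^ derived_length G) (carrier G) = {\<one>\<^bsub>G\<^esub>}"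
    unfolding derived_length_def by (rule LeastI_ex)
  then have series: "(derived G ^^ d) (carrier G) = {\<one>\<^bsub>G\<^esub>}" unfolding assms(4) .
  have D_eq: "D_subgroup G = D (carrier G)" by (simp add: D_subgroup_def D_def d_def)
  have sub: "subgroup (D_subgroup G) ?X" by (rule D_subgroup_is_subgroup) fact
  \<comment> \<open>Used with \<open>m = 1\<close> for odd and \<open>m = 2\<close> for even order;
    \<open>m * ?n\<close> is the number \<open>e\<close> of the descent.\<close>
  have bounds: "group_exponent (D_group G) dvd m ^ (d - 1) * ?n ^ d"
    "group_exponent ?X dvd m ^ (d - 1) * ?n ^ (d + 1)"
    if m: "m > 0" "?n dvd (m * ?n choose 2)" for m
  proof -
    have D: "x [^]\<^bsub>?X\<^esub> (m ^ (d - 1) * ?n ^ d) = \<one>\<^bsub>?X\<^esub>" if "x \<in> D (carrier G)" for x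
      using D_pow_derived_series[OF gen n(2) m(2) series that] .
    interpret DG: group "D_group G" unfolding D_group_def by (rule subgroup_imp_group[OF sub])
    show "group_exponent (D_group G) dvd m ^ (d - 1) * ?n ^ d"
      using D m n by (intro DG.group_exponent_dvdI) (simp_all add: D_group_def D_eq flip: nat_pow_consistent)
    show "group_exponent ?X dvd m ^ (d - 1) * ?n ^ (d + 1)"
    proof (rule group_exponent_dvdI)
      \<comment> \<open>The \<open>n\<close>-th power of \<open>x\<close> lies in
        \<open>D(G)\<close>, which accounts for the one additional factor.\<close>
      fix x assume x: "x \<in> carrier ?X"
      then have "(x [^]\<^bsub>?X\<^esub> ?n) [^]\<^bsub>?X\<^esub> (m ^ (d - 1) * ?n ^ d) = \<one>\<^bsub>?X\<^esub>"
        using D pow_in_D[OF gen n(2)] by simp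
      then show "x [^]\<^bsub>?X\<^esub> (m ^ (d - 1) * ?n ^ (d + 1)) = \<one>\<^bsub>?X\<^esub>"
        using x by (simp add: nat_pow_pow ac_simps)
    qed (use m n in simp)
  qed
  \<comment> \<open>\<open>?n\<close> divides the order and so is odd, which makes
    \<open>(?n - 1) / 2\<close> an integer; for \<open>2 * ?n\<close> the quotient is
    \<open>2 * ?n - 1\<close>.\<close>
  have "?n dvd (1 * ?n choose 2)" if "odd (order G)"
  proof -
    have "?n dvd order G"
      using assms(2) G.pow_order_eq_1 by (intro G.group_exponent_dvdI) (auto simp: G.order_gt_0_iff_finite)
    then have "odd ?n" using that dvd_trans by blast
    then obtain k where "?n = 2 * k + 1" by (rule oddE)
    then have "?n choose 2 = ?n * k" by (simp add: choose_two)
    then show ?thesis by simp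
  qed
  moreover have "?n dvd (2 * ?n choose 2)" by (simp add: choose_two)
  ultimately show ?thesis using bounds[of 1] bounds[of 2] by auto
qed

end
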